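(* Let $r=\sum_i x_i\otimes y_i$ be a quasitriangular $r$-matrix on a Lie algebra $\mathfrak g$. For any integer $n\ge1$, $r^{(n)}$ is a quasitriangular $r$-matrix on the direct product Lie algebra $\mathfrak g^n$, and the dual of $\delta_{r^{(n)}}:\mathfrak g^n\to\wedge^2\mathfrak g^n$ is the Lie bracket $[\,,\,]_{r^{(n)}}$ on $(\mathfrak g^* )^n\cong(\mathfrak g^n)^*$ given by $$[(\xi_1,\ldots,\xi_n),(\eta_1,\ldots,\eta_n)]_{r^{(n)}}=(\zeta_1,\ldots,\zeta_n),$$ where for $(\xi_1,\ldots,\xi_n),(\eta_1,\ldots,\eta_n)\in(\mathfrak g^* )^n$ and each $1\le j\le n$, $$\zeta_j=[\xi_j,\eta_j]+\mathrm{ad}^*_{r_-(\xi_1+\cdots+\xi_{j-1})+r_+(\xi_{j+1}+\cdots+\xi_n)}\eta_j-\mathrm{ad}^*_{r_-(\eta_1+\cdots+\eta_{j-1})+r_+(\eta_{j+1}+\cdots+\eta_n)}\xi_j .$$ Moreover, for any $1\le k\le m\le n$, the map $\phi_{m,k}:\mathfrak g^m\to\mathfrak g^n$ given by $$\phi_{m,k}(x_1,\ldots,x_m)=(x_1,\ldots,x_{k-1},\underbrace{x_k,\ldots,x_k}_{n-m+1\ \text{terms}},x_{k+1},\ldots,x_m)$$ is a Lie bialgebra homomorphism from $(\mathfrak g^m,\delta_{r^{(m)}})$ to $(\mathfrak g^n,\delta_{r^{(n)}})$.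
   Context: All Lie algebras are finite dimensional over $\mathbf k=\mathbb R$ or $\mathbb C$. A Lie bialgebra is a pair $(\mathfrak g,\delta)$ with $\delta:\mathfrak g\to\wedge^2\mathfrak g$ a 1-cocycle ($\delta[x,y]=[x,\delta(y)]+[\delta(x),y]$) whose dual map is a Lie bracket on $\mathfrak g^*$; a Lie bialgebra homomorphism is a Lie algebra homomorphism $\phi$ with $\phi\circ\delta_1=\delta_2\circ\phi$. Here $\wedge^2\mathfrak g\subset\mathfrak g\otimes\mathfrak g$, $u\wedge v=u\otimes v-v\otimes u$, and $\wedge^2\mathfrak g$, $\wedge^2\mathfrak g^*$ are paired by $\langle x\wedge y,\xi\wedge\eta\rangle=\langle x,\xi\rangle\langle y,\eta\rangle-\langle x,\eta\rangle\langle y,\xi\rangle$. $r\in\mathfrak g\otimes\mathfrak g$ is a quasitriangular $r$-matrix on $\mathfrak g$ if its symmetric part is ad-invariant and $[r_{12},r_{13}]+[r_{12},r_{23}]+[r_{13},r_{23}]=0$. Then $(\mathfrak g,\delta_r)$, $\delta_r(x)=\mathrm{ad}_xr=\sum_i([x,x_i]\otimes y_i+x_i\otimes[x,y_i])$, is a Lie bialgebra; the bracket $[\,,\,]$ on $\mathfrak g^*$ is the one dual to $\delta_r$. $r^{21}=\sum_i y_i\otimes x_i$; $r_+,r_-:\mathfrak g^*\to\mathfrak g$ are $r_+(\xi)=\sum_i\langle\xi,x_i\rangle y_i$, $r_-(\xi)=-\sum_i\langle\xi,y_i\rangle x_i$. The coadjoint action is $\langle\mathrm{ad}^*_x\xi,y\rangle=\langle\xi,[y,x]\rangle$.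 For $X\in\mathfrak g^{\otimes k}$, $(X)_j\in(\mathfrak g^n)^{\otimes k}$ is its image under the embedding of $\mathfrak g$ as the $j$-th summand of $\mathfrak g^n$. Define $$r^{(n)}=\sum_{j\ \mathrm{odd}}(r)_j+\sum_{j\ \mathrm{even}}(-r^{21})_j-\sum_{1\le j<k\le n}\sum_i(y_i)_j\wedge(x_i)_k\in\mathfrak g^n\otimes\mathfrak g^n .$$ *)

theory Defs
  imports Complex_Main "HOL-Library.Function_Algebras"
begin

text \<open>
  Function spaces carry their pointwise vector space structure; addition comes from
  \<^theory>\<open>HOL-Library.Function_Algebras\<close>. The field of scalars of the main statement is
  of class \<^class>\<open>real_normed_field\<close>: by the theorems of Gelfand-Mazur and Ostrowski the
  fields in this class are, up to isomorphism, exactly \<open>\<real>\<close> and \<open>\<complex>\<close>.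
\<close>

definition pointwise :: "('k \<Rightarrow> 'a \<Rightarrow> 'b) \<Rightarrow> 'k \<Rightarrow> ('i \<Rightarrow> 'a) \<Rightarrow> 'i \<Rightarrow> 'b" where
  "pointwise s c f = (\<lambda>i. s c (f i))"

definition linear_on ::
  "('k::field \<Rightarrow> 'a::ab_group_add \<Rightarrow> 'a) \<Rightarrow> 'a set \<Rightarrow> ('k \<Rightarrow> 'b::ab_group_add \<Rightarrow> 'b) \<Rightarrow> ('a \<Rightarrow> 'b) \<Rightarrow> bool"
  where
  "linear_on s V s' f \<longleftrightarrow>
     (\<forall>x\<in>V. \<forall>y\<in>V. f (x + y) = f x + f y) \<and> (\<forall>c. \<forall>x\<in>V. f (s c x) = s' c (f x))"

definition bilinear_on ::
  "('k::field \<Rightarrow> 'a::ab_group_add \<Rightarrow> 'a) \<Rightarrow> 'a set \<Rightarrow> ('k \<Rightarrow> 'b::ab_group_add \<Rightarrow> 'b) \<Rightarrow>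
     ('a \<Rightarrow> 'a \<Rightarrow> 'b) \<Rightarrow> bool" where
  "bilinear_on s V s' f \<longleftrightarrow>
     (\<forall>x\<in>V. linear_on s V s' (\<lambda>y. f x y)) \<and> (\<forall>y\<in>V. linear_on s V s' (\<lambda>x. f x y))"

definition lie_bracket ::
  "('k::field \<Rightarrow> 'a::ab_group_add \<Rightarrow> 'a) \<Rightarrow> 'a set \<Rightarrow> ('a \<Rightarrow> 'a \<Rightarrow> 'a) \<Rightarrow> bool" where
  "lie_bracket s V b \<longleftrightarrow>
     (\<forall>x\<in>V. \<forall>y\<in>V. b x y \<in> V) \<and> bilinear_on s V s b \<and> (\<forall>x\<in>V. b x x = 0) \<and>
     (\<forall>x\<in>V. \<forall>y\<in>V. \<forall>z\<in>V. b x (b y z) + b y (b z x) + b z (b x y) = 0)"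

text \<open>
  The underlying space of a Lie algebra is a subspace of an ambient vector space (a whole type):
  the powers \<open>\<gg>\<^sup>n\<close>, for varying \<open>n\<close>, are subspaces of the one type \<open>nat \<Rightarrow> 'a\<close>.
  The data \<open>brk\<close> is relevant on \<open>lie_set\<close> only.
\<close>

record ('k, 'a) lie =
  lie_set :: "'a set"
  scl :: "'k \<Rightarrow> 'a \<Rightarrow> 'a"
  brk :: "'a \<Rightarrow> 'a \<Rightarrow> 'a"

definition fin_dim_space :: "('k::field \<Rightarrow> 'a::ab_group_add \<Rightarrow> 'a) \<Rightarrow> 'a set \<Rightarrow> bool" where
  "fin_dim_space s V \<longleftrightarrow> vector_space s \<and> (\<exists>B. finite B \<and> module.span s B = V)"

definition lie_algebra :: "('k::field, 'a::ab_group_add) lie \<Rightarrow> bool" where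
  "lie_algebra L \<longleftrightarrow>
     fin_dim_space (scl L) (lie_set L) \<and> lie_bracket (scl L) (lie_set L) (brk L)"

text \<open>Functionals are extended by \<open>0\<close> outside \<open>\<gg>\<close>, so that equality is equality of functions.\<close>

definition dual :: "('k::field, 'a::ab_group_add) lie \<Rightarrow> ('a \<Rightarrow> 'k) set" where
  "dual L = {\<xi>. linear_on (scl L) (lie_set L) (*) \<xi> \<and> (\<forall>x. x \<notin> lie_set L \<longrightarrow> \<xi> x = 0)}"

definition coad :: "('k::field, 'a::ab_group_add) lie \<Rightarrow> 'a \<Rightarrow> ('a \<Rightarrow> 'k) \<Rightarrow> 'a \<Rightarrow> 'k" where
  "coad L x \<xi> = (\<lambda>y. if y \<in> lie_set L then \<xi> (brk L y x) else 0)"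


section \<open>Tensors\<close>

text \<open>
  As \<open>\<gg>\<close> is finite dimensional, \<open>\<gg> \<otimes> \<gg>\<close> is the space of bilinear functions on
  \<open>\<gg>\<^sup>* \<times> \<gg>\<^sup>*\<close>, where \<open>x \<otimes> y\<close> sends \<open>(\<xi>, \<eta>)\<close> to \<open>\<langle>x,\<xi>\<rangle> \<langle>y,\<eta>\<rangle>\<close>. Hence the value of a tensor
  at \<open>(\<xi>, \<eta>)\<close> is its pairing with \<open>\<xi> \<otimes> \<eta>\<close>. Similarly for \<open>\<gg> \<otimes> \<gg> \<otimes> \<gg>\<close>.
\<close>

type_synonym ('k, 'a) tensor2 = "('a \<Rightarrow> 'k) \<Rightarrow> ('a \<Rightarrow> 'k) \<Rightarrow> 'k"
type_synonym ('k, 'a) tensor3 = "('a \<Rightarrow> 'k) \<Rightarrow> ('a \<Rightarrow> 'k) \<Rightarrow> ('a \<Rightarrow> 'k) \<Rightarrow> 'k"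

definition tensor :: "('k::field, 'a::ab_group_add) lie \<Rightarrow> 'a \<Rightarrow> 'a \<Rightarrow> ('k, 'a) tensor2" where
  "tensor L x y = (\<lambda>\<xi> \<eta>. if \<xi> \<in> dual L \<and> \<eta> \<in> dual L then \<xi> x * \<eta> y else 0)"

definition tensor3 :: "('k::field, 'a::ab_group_add) lie \<Rightarrow> 'a \<Rightarrow> 'a \<Rightarrow> 'a \<Rightarrow> ('k, 'a) tensor3" where
  "tensor3 L x y z =
     (\<lambda>\<xi> \<eta> \<theta>. if \<xi> \<in> dual L \<and> \<eta> \<in> dual L \<and> \<theta> \<in> dual L then \<xi> x * \<eta> y * \<theta> z else 0)"

definition wedge :: "('k::field, 'a::ab_group_add) lie \<Rightarrow> 'a \<Rightarrow> 'a \<Rightarrow> ('k, 'a) tensor2" where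
  "wedge L x y = tensor L x y - tensor L y x"

definition tensor_space :: "('k::field, 'a::ab_group_add) lie \<Rightarrow> ('k, 'a) tensor2 set" where
  "tensor_space L = {\<Sum>(x, y)\<leftarrow>ps. tensor L x y |ps. set ps \<subseteq> lie_set L \<times> lie_set L}"

definition wedge_space :: "('k::field, 'a::ab_group_add) lie \<Rightarrow> ('k, 'a) tensor2 set" where
  "wedge_space L = {\<Sum>(x, y)\<leftarrow>ps. wedge L x y |ps. set ps \<subseteq> lie_set L \<times> lie_set L}"

text \<open>
  The extension of a bilinear map \<open>f\<close> to tensors: \<open>tlift L f\<close> sends \<open>\<Sum>\<^sub>i x\<^sub>i \<otimes> y\<^sub>i\<close> to
  \<open>\<Sum>\<^sub>i f x\<^sub>i y\<^sub>i\<close>. Lemma \<open>tlift_sum\<close> below shows that the choice of the decomposition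
  is immaterial.
\<close>

definition tlift ::
  "('k::field, 'a::ab_group_add) lie \<Rightarrow> ('a \<Rightarrow> 'a \<Rightarrow> 'c::ab_group_add) \<Rightarrow> ('k, 'a) tensor2 \<Rightarrow> 'c" where
  "tlift L f t =
     (\<Sum>(x, y)\<leftarrow>(SOME ps. set ps \<subseteq> lie_set L \<times> lie_set L \<and> t = (\<Sum>(x, y)\<leftarrow>ps. tensor L x y)). f x y)"

lemma sum_list_fun_apply:
  fixes F :: "'p \<Rightarrow> 'a \<Rightarrow> 'b::comm_monoid_add"
  shows "(\<Sum>p\<leftarrow>ps. F p) a = (\<Sum>p\<leftarrow>ps. F p a)"
  by (induction ps) auto

lemma linear_on_sum:
  assumes lin: "linear_on s V s' f" and vs: "vector_space s" and vs': "vector_space s'"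
    and V: "module.subspace s V" and "finite C" "C \<subseteq> V"
  shows "f (\<Sum>b\<in>C. s (a b) b) = (\<Sum>b\<in>C. s' (a b) (f b))"
proof -
  interpret v: vector_space s by (rule vs)
  interpret v': vector_space s' by (rule vs')
  have f0: "f 0 = 0"
    using lin v.subspace_0[OF V] unfolding linear_on_def
    by (metis v'.scale_zero_left v.scale_zero_left)
  show ?thesis
    using \<open>finite C\<close> \<open>C \<subseteq> V\<close>
  proof (induction C rule: finite_induct)
    case (insert b C)
    have "s (a b) b \<in> V" using insert.prems v.subspace_scale[OF V] by auto
    moreover have "(\<Sum>b\<in>C. s (a b) b) \<in> V"
      using insert.prems by (intro v.subspace_sum[OF V] v.subspace_scale[OF V]) auto
    ultimately show ?case using lin insert unfolding linear_on_def by auto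
  qed (simp add: f0)
qed

lemma tlift_sum:
  assumes fd: "fin_dim_space (scl L) (lie_set L)"
    and vs': "vector_space s'" and f: "bilinear_on (scl L) (lie_set L) s' f"
    and ps: "set ps \<subseteq> lie_set L \<times> lie_set L"
  shows "tlift L f (\<Sum>(x, y)\<leftarrow>ps. tensor L x y) = (\<Sum>(x, y)\<leftarrow>ps. f x y)"
proof -
  let ?V = "lie_set L" and ?s = "scl L"
  interpret v: vector_space ?s using fd by (simp add: fin_dim_space_def)
  interpret v': vector_space s' by (rule vs')
  obtain B where B: "finite B" "v.span B = ?V" using fd by (auto simp: fin_dim_space_def)
  obtain C where C: "C \<subseteq> B" "v.independent C" "B \<subseteq> v.span C"
    by (rule v.maximal_independent_subset)
  have spC: "v.span C = ?V"
    using B C by (metis v.span_mono v.span_span subset_antisym)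
  have fC: "finite C" using B C finite_subset by blast
  have CV: "C \<subseteq> ?V" using spC v.span_superset by blast
  have V: "v.subspace ?V" using spC by (metis v.subspace_span)
  let ?r = "v.representation C"
  define e where "e b x = (if x \<in> ?V then ?r x b else 0)" for b x
  have e: "e b \<in> dual L" for b
    using v.subspace_add[OF V] v.subspace_scale[OF V]
    by (auto simp: dual_def linear_on_def e_def spC v.representation_add[OF C(2)]
        v.representation_scale[OF C(2)])
  have expand: "x = (\<Sum>b\<in>C. ?s (?r x b) b)" if "x \<in> ?V" for x
    using v.sum_representation_eq[OF C(2) _ fC order_refl, of x] that spC by simp
  have fexp: "f x y = (\<Sum>b\<in>C. \<Sum>c\<in>C. s' (e b x * e c y) (f b c))" if "x \<in> ?V" "y \<in> ?V" for x y
  proof -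
    have l1: "linear_on ?s ?V s' (\<lambda>x. f x y)" using f that by (simp add: bilinear_on_def)
    have l2: "linear_on ?s ?V s' (\<lambda>y. f b y)" if "b \<in> C" for b
      using f that CV by (auto simp: bilinear_on_def)
    have "f x y = (\<Sum>b\<in>C. s' (e b x) (f b y))"
      by (subst expand[OF that(1)],
          subst linear_on_sum[OF l1 v.vector_space_axioms vs' V fC CV]) (simp add: e_def that)
    also have "\<dots> = (\<Sum>b\<in>C. s' (e b x) (\<Sum>c\<in>C. s' (e c y) (f b c)))"
    proof (rule sum.cong)
      fix b assume b: "b \<in> C"
      show "s' (e b x) (f b y) = s' (e b x) (\<Sum>c\<in>C. s' (e c y) (f b c))"
        by (subst expand[OF that(2)],
            subst linear_on_sum[OF l2[OF b] v.vector_space_axioms vs' V fC CV]) (simp add: e_def that)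
    qed simp
    finally show ?thesis by (simp add: v'.scale_sum_right)
  qed
  have main: "(\<Sum>(x, y)\<leftarrow>qs. f x y) =
      (\<Sum>b\<in>C. \<Sum>c\<in>C. s' ((\<Sum>(x, y)\<leftarrow>qs. tensor L x y) (e b) (e c)) (f b c))"
    if "set qs \<subseteq> ?V \<times> ?V" for qs
    using that
  proof (induction qs)
    case (Cons q qs)
    obtain x y where q: "q = (x, y)" by (cases q)
    show ?case using Cons fexp[of x y]
      by (simp add: q tensor_def e v'.scale_left_distrib sum.distrib)
  qed simp
  define t where "t = (\<Sum>(x, y)\<leftarrow>ps. tensor L x y)"
  define qs where "qs = (SOME qs. set qs \<subseteq> ?V \<times> ?V \<and> t = (\<Sum>(x, y)\<leftarrow>qs. tensor L x y))"
  have qs: "set qs \<subseteq> ?V \<times> ?V \<and> t = (\<Sum>(x, y)\<leftarrow>qs. tensor L x y)"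
    unfolding qs_def by (rule someI[of _ ps]) (simp add: ps t_def)
  have "tlift L f t = (\<Sum>(x, y)\<leftarrow>qs. f x y)"
    by (simp add: tlift_def qs_def)
  also have "\<dots> = (\<Sum>b\<in>C. \<Sum>c\<in>C. s' (t (e b) (e c)) (f b c))"
    using main[of qs] qs by metis
  also have "\<dots> = (\<Sum>(x, y)\<leftarrow>ps. f x y)"
    using main[OF ps] by (metis t_def)
  finally show ?thesis by (simp add: t_def)
qed

text \<open>The pairing of \<open>\<wedge>\<^sup>2\<gg>\<close> with \<open>\<wedge>\<^sup>2\<gg>\<^sup>*\<close> is evaluation: \<open>\<langle>t, \<xi> \<wedge> \<eta>\<rangle> = t \<xi> \<eta>\<close>.\<close>

lemma wedge_apply:
  assumes "\<xi> \<in> dual L" "\<eta> \<in> dual L"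
  shows "wedge L x y \<xi> \<eta> = \<xi> x * \<eta> y - \<eta> x * \<xi> y"
  using assms by (simp add: wedge_def tensor_def)


section \<open>Lie bialgebras\<close>

definition ad2 ::
  "('k::field, 'a::ab_group_add) lie \<Rightarrow> 'a \<Rightarrow> ('k, 'a) tensor2 \<Rightarrow> ('k, 'a) tensor2" where
  "ad2 L x = tlift L (\<lambda>u v. tensor L (brk L x u) v + tensor L u (brk L x v))"

definition dual_bracket ::
  "('k::field, 'a::ab_group_add) lie \<Rightarrow> ('a \<Rightarrow> ('k, 'a) tensor2) \<Rightarrow>
     ('a \<Rightarrow> 'k) \<Rightarrow> ('a \<Rightarrow> 'k) \<Rightarrow> 'a \<Rightarrow> 'k" where
  "dual_bracket L \<delta> \<xi> \<eta> = (\<lambda>x. if x \<in> lie_set L then \<delta> x \<xi> \<eta> else 0)"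

text \<open>In the cocycle condition, \<open>[\<delta>(x), y]\<close> is \<open>- [y, \<delta>(x)]\<close>.\<close>

definition lie_bialgebra ::
  "('k::field, 'a::ab_group_add) lie \<Rightarrow> ('a \<Rightarrow> ('k, 'a) tensor2) \<Rightarrow> bool" where
  "lie_bialgebra L \<delta> \<longleftrightarrow>
     lie_algebra L \<and>
     (\<forall>x\<in>lie_set L. \<delta> x \<in> wedge_space L) \<and>
     linear_on (scl L) (lie_set L) (pointwise (pointwise (*))) \<delta> \<and>
     (\<forall>x\<in>lie_set L. \<forall>y\<in>lie_set L. \<delta> (brk L x y) = ad2 L x (\<delta> y) - ad2 L y (\<delta> x)) \<and>
     lie_bracket (pointwise (*)) (dual L) (dual_bracket L \<delta>)"

definition lie_hom ::
  "('k::field, 'a::ab_group_add) lie \<Rightarrow> ('k, 'b::ab_group_add) lie \<Rightarrow> ('a \<Rightarrow> 'b) \<Rightarrow> bool" where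
  "lie_hom L M \<phi> \<longleftrightarrow>
     \<phi> ` lie_set L \<subseteq> lie_set M \<and> linear_on (scl L) (lie_set L) (scl M) \<phi> \<and>
     (\<forall>x\<in>lie_set L. \<forall>y\<in>lie_set L. \<phi> (brk L x y) = brk M (\<phi> x) (\<phi> y))"

definition tensor_map ::
  "('k::field, 'a::ab_group_add) lie \<Rightarrow> ('k, 'b::ab_group_add) lie \<Rightarrow> ('a \<Rightarrow> 'b) \<Rightarrow>
     ('k, 'a) tensor2 \<Rightarrow> ('k, 'b) tensor2" where
  "tensor_map L M \<phi> = tlift L (\<lambda>x y. tensor M (\<phi> x) (\<phi> y))"

definition lie_bialgebra_hom ::
  "('k::field, 'a::ab_group_add) lie \<Rightarrow> ('a \<Rightarrow> ('k, 'a) tensor2) \<Rightarrow>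
     ('k, 'b::ab_group_add) lie \<Rightarrow> ('b \<Rightarrow> ('k, 'b) tensor2) \<Rightarrow> ('a \<Rightarrow> 'b) \<Rightarrow> bool" where
  "lie_bialgebra_hom L \<delta> M \<delta>' \<phi> \<longleftrightarrow>
     lie_bialgebra L \<delta> \<and> lie_bialgebra M \<delta>' \<and> lie_hom L M \<phi> \<and>
     (\<forall>x\<in>lie_set L. tensor_map L M \<phi> (\<delta> x) = \<delta>' (\<phi> x))"


section \<open>Quasitriangular r-matrices\<close>

definition flip_tensor ::
  "('k::field, 'a::ab_group_add) lie \<Rightarrow> ('k, 'a) tensor2 \<Rightarrow> ('k, 'a) tensor2" where
  "flip_tensor L = tlift L (\<lambda>x y. tensor L y x)"

definition sym_part ::
  "('k::field, 'a::ab_group_add) lie \<Rightarrow> ('k, 'a) tensor2 \<Rightarrow> ('k, 'a) tensor2" where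
  "sym_part L r = pointwise (pointwise (*)) (1/2) (r + flip_tensor L r)"

text \<open>
  With \<open>r = \<Sum>\<^sub>i x\<^sub>i \<otimes> y\<^sub>i\<close> the three terms are \<open>\<Sum>\<^sub>i\<^sub>,\<^sub>j [x\<^sub>i,x\<^sub>j] \<otimes> y\<^sub>i \<otimes> y\<^sub>j\<close>,
  \<open>\<Sum>\<^sub>i\<^sub>,\<^sub>j x\<^sub>i \<otimes> [y\<^sub>i,x\<^sub>j] \<otimes> y\<^sub>j\<close> and \<open>\<Sum>\<^sub>i\<^sub>,\<^sub>j x\<^sub>i \<otimes> x\<^sub>j \<otimes> [y\<^sub>i,y\<^sub>j]\<close>.
\<close>

definition yang_baxter ::
  "('k::field, 'a::ab_group_add) lie \<Rightarrow> ('k, 'a) tensor2 \<Rightarrow> ('k, 'a) tensor3" where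
  "yang_baxter L r =
     tlift L (\<lambda>x y. tlift L (\<lambda>x' y'. tensor3 L (brk L x x') y y') r) r +
     tlift L (\<lambda>x y. tlift L (\<lambda>x' y'. tensor3 L x (brk L y x') y') r) r +
     tlift L (\<lambda>x y. tlift L (\<lambda>x' y'. tensor3 L x x' (brk L y y')) r) r"

definition quasitriangular ::
  "('k::field, 'a::ab_group_add) lie \<Rightarrow> ('k, 'a) tensor2 \<Rightarrow> bool" where
  "quasitriangular L r \<longleftrightarrow>
     lie_algebra L \<and> r \<in> tensor_space L \<and>
     (\<forall>x\<in>lie_set L. ad2 L x (sym_part L r) = 0) \<and> yang_baxter L r = 0"

definition cobracket ::
  "('k::field, 'a::ab_group_add) lie \<Rightarrow> ('k, 'a) tensor2 \<Rightarrow> 'a \<Rightarrow> ('k, 'a) tensor2" where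
  "cobracket L r x = ad2 L x r"

definition r_plus ::
  "('k::field, 'a::ab_group_add) lie \<Rightarrow> ('k, 'a) tensor2 \<Rightarrow> ('a \<Rightarrow> 'k) \<Rightarrow> 'a" where
  "r_plus L r \<xi> = tlift L (\<lambda>x y. scl L (\<xi> x) y) r"

definition r_minus ::
  "('k::field, 'a::ab_group_add) lie \<Rightarrow> ('k, 'a) tensor2 \<Rightarrow> ('a \<Rightarrow> 'k) \<Rightarrow> 'a" where
  "r_minus L r \<xi> = - tlift L (\<lambda>x y. scl L (\<xi> y) x) r"


section \<open>Direct powers\<close>

text \<open>An \<open>n\<close>-tuple is a function that vanishes outside the index set \<open>{1..n}\<close>.\<close>

definition tuples :: "nat \<Rightarrow> 'a::zero set \<Rightarrow> (nat \<Rightarrow> 'a) set" where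
  "tuples n V = {x. (\<forall>i\<in>{1..n}. x i \<in> V) \<and> (\<forall>i. i \<notin> {1..n} \<longrightarrow> x i = 0)}"

definition lie_power ::
  "('k::field, 'a::ab_group_add) lie \<Rightarrow> nat \<Rightarrow> ('k, nat \<Rightarrow> 'a) lie" where
  "lie_power L n =
     \<lparr>lie_set = tuples n (lie_set L), scl = pointwise (scl L),
      brk = (\<lambda>x y i. if i \<in> {1..n} then brk L (x i) (y i) else 0)\<rparr>"

definition summand :: "nat \<Rightarrow> 'a::zero \<Rightarrow> nat \<Rightarrow> 'a" where
  "summand j x = (\<lambda>i. if i = j then x else 0)"

definition tensor_summand ::
  "('k::field, 'a::ab_group_add) lie \<Rightarrow> nat \<Rightarrow> nat \<Rightarrow> ('k, 'a) tensor2 \<Rightarrow> ('k, nat \<Rightarrow> 'a) tensor2" where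
  "tensor_summand L n j = tensor_map L (lie_power L n) (summand j)"

definition r_power ::
  "('k::field, 'a::ab_group_add) lie \<Rightarrow> ('k, 'a) tensor2 \<Rightarrow> nat \<Rightarrow> ('k, nat \<Rightarrow> 'a) tensor2" where
  "r_power L r n =
     (\<Sum>j | j \<in> {1..n} \<and> odd j. tensor_summand L n j r) +
     (\<Sum>j | j \<in> {1..n} \<and> even j. tensor_summand L n j (- flip_tensor L r)) -
     (\<Sum>k\<in>{1..n}. \<Sum>j\<in>{1..<k}.
        tlift L (\<lambda>x y. wedge (lie_power L n) (summand j y) (summand k x)) r)"

text \<open>The canonical isomorphism from \<open>(\<gg>\<^sup>*)\<^sup>n\<close> to \<open>(\<gg>\<^sup>n)\<^sup>*\<close>.\<close>

definition dual_tuple ::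
  "('k::field, 'a::ab_group_add) lie \<Rightarrow> nat \<Rightarrow> (nat \<Rightarrow> 'a \<Rightarrow> 'k) \<Rightarrow> (nat \<Rightarrow> 'a) \<Rightarrow> 'k" where
  "dual_tuple L n \<xi> =
     (\<lambda>x. if x \<in> lie_set (lie_power L n) then \<Sum>j\<in>{1..n}. \<xi> j (x j) else 0)"

lemma bij_betw_dual_tuple:
  fixes L :: "('k::field, 'a::ab_group_add) lie"
  assumes "lie_algebra L"
  shows "bij_betw (dual_tuple L n) (tuples n (dual L)) (dual (lie_power L n))"
proof -
  let ?V = "lie_set L" and ?s = "scl L"
  interpret v: vector_space ?s using assms by (simp add: lie_algebra_def fin_dim_space_def)
  have V: "v.subspace ?V"
  proof -
    obtain B where "v.span B = ?V" using assms by (auto simp: lie_algebra_def fin_dim_space_def)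
    then show ?thesis using v.subspace_span[of B] by simp
  qed
  note V0 = v.subspace_0[OF V] and Vadd = v.subspace_add[OF V] and Vs = v.subspace_scale[OF V]
  have d0: "\<xi> 0 = 0" if "\<xi> \<in> dual L" for \<xi>
  proof -
    have "\<xi> (0 + 0) = \<xi> 0 + \<xi> 0" using that V0 unfolding dual_def linear_on_def by blast
    then show ?thesis by (metis add_0 add_cancel_left_left)
  qed
  have sm: "summand j x \<in> tuples n ?V" if "x \<in> ?V" "j \<in> {1..n}" for j x
    using that V0 by (auto simp: summand_def tuples_def)
  define g where
    "g \<zeta> = (\<lambda>j x. if j \<in> {1..n} \<and> x \<in> ?V then \<zeta> (summand j x) else 0)"
    for \<zeta> :: "(nat \<Rightarrow> 'a) \<Rightarrow> 'k"
  have padd: "x + y \<in> tuples n ?V" if "x \<in> tuples n ?V" "y \<in> tuples n ?V" for x y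
    using that Vadd by (auto simp: tuples_def)
  have psc: "pointwise ?s c x \<in> tuples n ?V" if "x \<in> tuples n ?V" for c x
    using that Vs by (auto simp: tuples_def pointwise_def)
  show ?thesis
  proof (rule bij_betw_byWitness[where f' = g])
    show "\<forall>\<xi>\<in>tuples n (dual L). g (dual_tuple L n \<xi>) = \<xi>"
    proof (intro ballI ext)
      fix \<xi> j x assume \<xi>: "\<xi> \<in> tuples n (dual L)"
      show "g (dual_tuple L n \<xi>) j x = \<xi> j x"
      proof (cases "j \<in> {1..n} \<and> x \<in> ?V")
        case True
        have "(\<Sum>i\<in>{1..n}. \<xi> i (summand j x i)) = (\<Sum>i\<in>{1..n}. if i = j then \<xi> j x else 0)"
          using \<xi> d0 by (intro sum.cong) (auto simp: summand_def tuples_def)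
        also have "\<dots> = \<xi> j x" using True by simp
        finally show ?thesis
          using True sm by (simp add: g_def dual_tuple_def lie_power_def)
      next
        case False
        then show ?thesis
          using \<xi> by (cases "j \<in> {1..n}") (auto simp: g_def tuples_def dual_def)
      qed
    qed
  next
    show "\<forall>\<zeta>\<in>dual (lie_power L n). dual_tuple L n (g \<zeta>) = \<zeta>"
    proof (intro ballI ext)
      fix \<zeta> x assume \<zeta>: "\<zeta> \<in> dual (lie_power L n)"
      have \<zeta>add: "\<zeta> (x + y) = \<zeta> x + \<zeta> y" if "x \<in> tuples n ?V" "y \<in> tuples n ?V" for x y
        using \<zeta> that by (auto simp: dual_def linear_on_def lie_power_def)
      have z: "(0 :: nat \<Rightarrow> 'a) \<in> tuples n ?V" using V0 by (simp add: tuples_def)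
      have \<zeta>0: "\<zeta> 0 = 0" using \<zeta>add[OF z z] by (metis add_0 add_cancel_left_left)
      show "dual_tuple L n (g \<zeta>) x = \<zeta> x"
      proof (cases "x \<in> tuples n ?V")
        case True
        have part: "\<zeta> (\<Sum>j\<in>J. summand j (x j)) = (\<Sum>j\<in>J. \<zeta> (summand j (x j)))
            \<and> (\<Sum>j\<in>J. summand j (x j)) \<in> tuples n ?V" if "finite J" "J \<subseteq> {1..n}" for J
          using that
        proof (induction J rule: finite_induct)
          case empty
          then show ?case using \<zeta>0 z unfolding sum.empty by blast
        next
          case (insert j J)
          have "summand j (x j) \<in> tuples n ?V"
            using insert.prems True by (intro sm) (auto simp: tuples_def)
          moreover have "\<zeta> (\<Sum>i\<in>J. summand i (x i)) = (\<Sum>i\<in>J. \<zeta> (summand i (x i)))"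
            "(\<Sum>i\<in>J. summand i (x i)) \<in> tuples n ?V"
            using insert.IH insert.prems by blast+
          ultimately show ?case
            unfolding sum.insert[OF insert.hyps] using \<zeta>add padd by metis
        qed
        have "(\<Sum>j\<in>{1..n}. summand j (x j)) = x"
        proof
          fix i
          have ev: "(\<Sum>j\<in>J. summand j (x j)) i = (\<Sum>j\<in>J. summand j (x j) i)" if "finite J" for J
            using that by (induction J rule: finite_induct) auto
          have "(\<Sum>j\<in>{1..n}. summand j (x j) i) = x i"
            using True by (simp add: summand_def tuples_def)
          then show "(\<Sum>j\<in>{1..n}. summand j (x j)) i = x i"
            using ev[of "{1..n}"] by simp
        qed
        then have "\<zeta> x = (\<Sum>j\<in>{1..n}. \<zeta> (summand j (x j)))"
          using part[of "{1..n}"] by simp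
        also have "\<dots> = (\<Sum>j\<in>{1..n}. g \<zeta> j (x j))"
          using True by (intro sum.cong) (auto simp: g_def tuples_def)
        finally show ?thesis using True by (simp add: dual_tuple_def lie_power_def)
      next
        case False
        then show ?thesis using \<zeta> by (simp add: dual_tuple_def lie_power_def dual_def)
      qed
    qed
  next
    show "dual_tuple L n ` tuples n (dual L) \<subseteq> dual (lie_power L n)"
    proof safe
      fix \<xi> assume \<xi>: "\<xi> \<in> tuples n (dual L)"
      have \<xi>lin: "\<xi> j (x + y) = \<xi> j x + \<xi> j y" "\<xi> j (?s c x) = c * \<xi> j x"
        if "j \<in> {1..n}" "x \<in> ?V" "y \<in> ?V" for j x y c
        using \<xi> that by (auto simp: tuples_def dual_def linear_on_def)
      have mem: "x j \<in> ?V" if "x \<in> tuples n ?V" "j \<in> {1..n}" for x j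
        using that unfolding tuples_def by blast
      have "dual_tuple L n \<xi> (x + y) = dual_tuple L n \<xi> x + dual_tuple L n \<xi> y"
        if xy: "x \<in> tuples n ?V" "y \<in> tuples n ?V" for x y
      proof -
        have "(\<Sum>j\<in>{1..n}. \<xi> j ((x + y) j)) = (\<Sum>j\<in>{1..n}. \<xi> j (x j) + \<xi> j (y j))"
          by (rule sum.cong) (simp_all only: plus_fun_apply \<xi>lin(1)[OF _ mem[OF xy(1)] mem[OF xy(2)]])
        then show ?thesis
          using xy padd[OF xy] by (simp add: dual_tuple_def lie_power_def sum.distrib)
      qed
      moreover have "dual_tuple L n \<xi> (pointwise ?s c x) = c * dual_tuple L n \<xi> x"
        if x: "x \<in> tuples n ?V" for c x
      proof -
        have "(\<Sum>j\<in>{1..n}. \<xi> j (pointwise ?s c x j)) = (\<Sum>j\<in>{1..n}. c * \<xi> j (x j))"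
          by (rule sum.cong) (simp_all only: pointwise_def \<xi>lin(2)[OF _ mem[OF x] V0])
        then show ?thesis
          using x psc[OF x] by (simp add: dual_tuple_def lie_power_def sum_distrib_left)
      qed
      ultimately show "dual_tuple L n \<xi> \<in> dual (lie_power L n)"
        by (auto simp: dual_def linear_on_def lie_power_def dual_tuple_def)
    qed
  next
    show "g ` dual (lie_power L n) \<subseteq> tuples n (dual L)"
    proof safe
      fix \<zeta> assume \<zeta>: "\<zeta> \<in> dual (lie_power L n)"
      have sadd: "summand j (x + y) = summand j x + summand j y" for j and x y :: 'a
        by (auto simp: summand_def)
      have ssc: "summand j (?s c x) = pointwise ?s c (summand j x)" for j c x
        by (auto simp: summand_def pointwise_def)
      have "g \<zeta> j \<in> dual L" if "j \<in> {1..n}" for j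
        using \<zeta> that sm[OF _ that] Vadd Vs
        by (auto simp: dual_def linear_on_def lie_power_def g_def sadd ssc)
      then show "g \<zeta> \<in> tuples n (dual L)"
        by (auto simp: tuples_def g_def)
    qed
  qed
qed

definition power_dual_bracket ::
  "('k::field, 'a::ab_group_add) lie \<Rightarrow> ('k, 'a) tensor2 \<Rightarrow> nat \<Rightarrow>
     (nat \<Rightarrow> 'a \<Rightarrow> 'k) \<Rightarrow> (nat \<Rightarrow> 'a \<Rightarrow> 'k) \<Rightarrow> nat \<Rightarrow> 'a \<Rightarrow> 'k" where
  "power_dual_bracket L r n \<xi> \<eta> =
     (\<lambda>j. if j \<in> {1..n} then
        dual_bracket L (cobracket L r) (\<xi> j) (\<eta> j)
        + coad L (r_minus L r (\<Sum>i\<in>{1..<j}. \<xi> i) + r_plus L r (\<Sum>i\<in>{j<..n}. \<xi> i)) (\<eta> j)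
        - coad L (r_minus L r (\<Sum>i\<in>{1..<j}. \<eta> i) + r_plus L r (\<Sum>i\<in>{j<..n}. \<eta> i)) (\<xi> j)
      else 0)"

text \<open>\<open>repeat_entry n m k\<close> maps \<open>m\<close>-tuples to \<open>n\<close>-tuples, repeating the \<open>k\<close>-th entry
  \<open>n - m + 1\<close> times.\<close>

definition repeat_entry :: "nat \<Rightarrow> nat \<Rightarrow> nat \<Rightarrow> (nat \<Rightarrow> 'a::zero) \<Rightarrow> nat \<Rightarrow> 'a" where
  "repeat_entry n m k x =
     (\<lambda>i. if i \<notin> {1..n} then 0
          else if i < k then x i
          else if i \<le> k + (n - m) then x k
          else x (i - (n - m)))"

end

theory Submission
  imports Defs
begin

text \<open>
  The tensor \<open>r\<close> enters through the maps \<open>p = r\<^sub>+\<close> and \<open>q = r\<^sub>-\<close> from \<open>\<gg>\<^sup>*\<close> to \<open>\<gg>\<close> and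
  through \<open>s = p - q\<close>, which is twice the symmetric part. By \<open>quasitriangular_iff\<close>, quasitriangularity
  says that \<open>\<langle>\<xi>, [x, s \<eta>]\<rangle>\<close> is skew in \<open>(\<xi>, \<eta>)\<close> (invariance), and that
  \<open>\<langle>\<xi>, [q \<eta>, q \<theta>]\<rangle> - \<langle>\<eta>, [p \<xi>, q \<theta>]\<rangle> + \<langle>\<theta>, [p \<xi>, p \<eta>]\<rangle> = 0\<close> (the Yang-Baxter equation). These two
  identities make \<open>q\<close> a homomorphism for the bracket on \<open>\<gg>\<^sup>*\<close>, and with it the Jacobi identity of that
  bracket follows from the one of \<open>\<gg>\<close>; this is the general fact \<open>lie_bialgebra\<close> that a quasitriangular \<open>r\<close>-matrix
  defines a Lie bialgebra.

  For the powers, let \<open>\<sigma>\<^sub>j = \<xi>\<^sub>1 + \<dots> + \<xi>\<^sub>j\<close> and \<open>U\<^sub>j = p(\<sigma>\<^sub>n) - s(\<sigma>\<^sub>j)\<close>. The points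
  \<open>U\<^sub>0, \<dots>, U\<^sub>n\<close> lead from \<open>p(\<sigma>\<^sub>n)\<close> to \<open>q(\<sigma>\<^sub>n)\<close>. The two maps attached to \<open>r\<^sup>(\<^sup>n\<^sup>)\<close> send
  \<open>(\<xi>\<^sub>1, \<dots>, \<xi>\<^sub>n)\<close> to the tuples whose \<open>j\<close>-th entries are \<open>U\<^sub>j\<^sub>-\<^sub>1\<close> and \<open>U\<^sub>j\<close>, in this order for odd \<open>j\<close> and
  in the opposite order for even \<open>j\<close> (\<open>r_plus_power\<close>, \<open>r_minus_power\<close>). So the \<open>j\<close>-th summand of
  each expression that has to be computed belongs to the step from \<open>\<sigma>\<^sub>j\<^sub>-\<^sub>1\<close> to \<open>\<sigma>\<^sub>j\<close>. Invariance alone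
  makes it the increment of a potential along this step (\<open>yang_baxter_potential_difference\<close>,
  \<open>bracket_potential_difference\<close>). An increment changes sign when the step is reversed, which is why the
  tensors \<open>r\<close> and \<open>- r\<^sup>2\<^sup>1\<close> may alternate, and sums of increments telescope:

  \<^item> The Yang-Baxter expression of \<open>r\<^sup>(\<^sup>n\<^sup>)\<close> at three tuples is the Yang-Baxter expression of \<open>r\<close> at their
  totals, hence \<open>0\<close>.

  \<^item> The dual bracket of two tuples, evaluated at \<open>(x\<^sub>1, \<dots>, x\<^sub>n)\<close>, is the sum of the increments of the
  potential at \<open>x\<^sub>j\<close> from \<open>j - 1\<close> to \<open>j\<close>. Its \<open>j\<close>-th summand is the asserted \<open>\<zeta>\<^sub>j\<close> at \<open>x\<^sub>j\<close>.

  \<^item> On a block of equal entries the increments collapse to a single one (\<open>sum_repeat_entry\<close>). Pulling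
  functionals back along \<open>\<phi>\<^sub>m\<^sub>,\<^sub>k\<close> adds up the functionals of the block, so it passes to a subsequence of
  the partial sums, and both cobrackets are given by the same telescoping sum.
\<close>

section \<open>Lie algebras, functionals and tensors\<close>

locale lie_alg =
  fixes L :: "('k::field_char_0, 'a::ab_group_add) lie"
  assumes lie: "lie_algebra L"
begin

abbreviation V where "V \<equiv> lie_set L"
abbreviation br where "br \<equiv> brk L"
abbreviation sc where "sc \<equiv> scl L"

sublocale vs: vector_space "scl L"
  using lie by (simp add: lie_algebra_def fin_dim_space_def)

lemma subspace: "vs.subspace V"
proof -
  obtain B where "vs.span B = V"
    using lie by (auto simp: lie_algebra_def fin_dim_space_def)
  then show ?thesis using vs.subspace_span[of B] by simp
qed

lemmas closed [simp] = vs.subspace_0[OF subspace] vs.subspace_add[OF subspace]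
  vs.subspace_diff[OF subspace] vs.subspace_neg[OF subspace] vs.subspace_scale[OF subspace]

lemma brk_closed [simp]: "x \<in> V \<Longrightarrow> y \<in> V \<Longrightarrow> br x y \<in> V"
  using lie by (simp add: lie_algebra_def lie_bracket_def)

lemma brk_add [simp]:
  assumes "x \<in> V" "y \<in> V" "z \<in> V"
  shows "br (x + y) z = br x z + br y z" "br x (y + z) = br x y + br x z"
  using assms lie by (simp_all add: lie_algebra_def lie_bracket_def bilinear_on_def linear_on_def)

lemma brk_scale [simp]:
  assumes "x \<in> V" "y \<in> V"
  shows "br (sc c x) y = sc c (br x y)" "br x (sc c y) = sc c (br x y)"
  using assms lie by (simp_all add: lie_algebra_def lie_bracket_def bilinear_on_def linear_on_def)

lemma brk_self [simp]: "x \<in> V \<Longrightarrow> br x x = 0"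
  using lie by (simp add: lie_algebra_def lie_bracket_def)

lemma brk_diff [simp]:
  assumes "x \<in> V" "y \<in> V" "z \<in> V"
  shows "br (x - y) z = br x z - br y z" "br x (y - z) = br x y - br x z"
  using brk_add(1)[of "x - y" y z] brk_add(2)[of x "y - z" z] assms by (simp_all add: algebra_simps)

lemma brk_zero [simp]: "x \<in> V \<Longrightarrow> br 0 x = 0" "x \<in> V \<Longrightarrow> br x 0 = 0"
  using brk_diff[of x x x] by simp_all

lemma brk_minus [simp]:
  "x \<in> V \<Longrightarrow> y \<in> V \<Longrightarrow> br (- x) y = - br x y" "x \<in> V \<Longrightarrow> y \<in> V \<Longrightarrow> br x (- y) = - br x y"
  using brk_diff(1)[of 0 x y] brk_diff(2)[of x 0 y] by simp_all

lemma brk_anticomm: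
  assumes "x \<in> V" "y \<in> V"
  shows "br x y = - br y x"
proof -
  have "br (x + y) (x + y) = br x x + br x y + (br y x + br y y)"
    using assms by (simp del: brk_self)
  then have "br x y + br y x = 0"
    using assms by simp
  then show ?thesis by (rule eq_neg_iff_add_eq_0[THEN iffD2])
qed

lemma brk_jacobi:
  assumes "x \<in> V" "y \<in> V" "z \<in> V"
  shows "br x (br y z) = br (br x y) z + br y (br x z)"
proof -
  have "br x (br y z) + br y (br z x) + br z (br x y) = 0"
    using lie assms by (simp add: lie_algebra_def lie_bracket_def)
  moreover have "br y (br z x) = - br y (br x z)" "br z (br x y) = - br (br x y) z"
    using assms brk_anticomm[of z x] brk_anticomm[of z "br x y"] by simp_all
  ultimately show ?thesis by (simp add: algebra_simps)
qed

lemma dual_eval [simp]: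
  assumes "\<xi> \<in> dual L" "x \<in> V"
  shows "\<xi> (sc c x) = c * \<xi> x" and "y \<in> V \<Longrightarrow> \<xi> (x + y) = \<xi> x + \<xi> y"
    and "y \<in> V \<Longrightarrow> \<xi> (x - y) = \<xi> x - \<xi> y" and "\<xi> (- x) = - \<xi> x"
proof -
  have add: "\<xi> (x + y) = \<xi> x + \<xi> y" if "x \<in> V" "y \<in> V" for x y
    using assms that by (simp add: dual_def linear_on_def)
  have scale: "\<xi> (sc c x) = c * \<xi> x" for c
    using assms by (simp add: dual_def linear_on_def)
  show "\<xi> (sc c x) = c * \<xi> x" "y \<in> V \<Longrightarrow> \<xi> (x + y) = \<xi> x + \<xi> y"
    using scale add assms by auto
  show "\<xi> (x - y) = \<xi> x - \<xi> y" if "y \<in> V"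
    using add[of "x - y" y] assms that by simp
  show "\<xi> (- x) = - \<xi> x"
    using scale[of "-1"] by simp
qed

lemma dual_0 [simp]: "\<xi> \<in> dual L \<Longrightarrow> \<xi> 0 = 0"
  using dual_eval(3)[of \<xi> 0 0] by simp

lemma dual_outside: "\<xi> \<in> dual L \<Longrightarrow> x \<notin> V \<Longrightarrow> \<xi> x = 0"
  by (simp add: dual_def)

lemma dual_eqI:
  assumes "\<xi> \<in> dual L" "\<eta> \<in> dual L" "\<And>x. x \<in> V \<Longrightarrow> \<xi> x = \<eta> x"
  shows "\<xi> = \<eta>"
proof
  show "\<xi> x = \<eta> x" for x
    using assms dual_outside[OF assms(1)] dual_outside[OF assms(2)] by (cases "x \<in> V") auto
qed

lemma dualI:
  assumes "\<And>x y. x \<in> V \<Longrightarrow> y \<in> V \<Longrightarrow> \<xi> (x + y) = \<xi> x + \<xi> y"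
    and "\<And>c x. x \<in> V \<Longrightarrow> \<xi> (sc c x) = c * \<xi> x"
    and "\<And>x. x \<notin> V \<Longrightarrow> \<xi> x = 0"
  shows "\<xi> \<in> dual L"
  unfolding dual_def linear_on_def using assms by blast

lemma dual_closed [simp]:
  "0 \<in> dual L"
  "\<xi> \<in> dual L \<Longrightarrow> \<eta> \<in> dual L \<Longrightarrow> \<xi> + \<eta> \<in> dual L"
  "\<xi> \<in> dual L \<Longrightarrow> \<eta> \<in> dual L \<Longrightarrow> \<xi> - \<eta> \<in> dual L"
  "\<xi> \<in> dual L \<Longrightarrow> - \<xi> \<in> dual L"
  "\<xi> \<in> dual L \<Longrightarrow> pointwise (*) c \<xi> \<in> dual L"
  by (rule dualI; simp add: dual_outside pointwise_def algebra_simps)+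

lemma dual_sum [simp]: "(\<And>i. i \<in> I \<Longrightarrow> \<xi> i \<in> dual L) \<Longrightarrow> sum \<xi> I \<in> dual L"
  by (induction I rule: infinite_finite_induct) (simp_all del: plus_fun_apply)

lemma coad_dual [simp]: "x \<in> V \<Longrightarrow> \<xi> \<in> dual L \<Longrightarrow> coad L x \<xi> \<in> dual L"
  by (rule dualI) (auto simp: coad_def)

lemma coad_apply [simp]: "y \<in> V \<Longrightarrow> coad L x \<xi> y = \<xi> (br y x)"
  by (simp add: coad_def)

text \<open>Coordinate functions with respect to a basis separate the points.\<close>

lemma dual_separates:
  assumes "x \<in> V" "y \<in> V" and eq: "\<And>\<xi>. \<xi> \<in> dual L \<Longrightarrow> \<xi> x = \<xi> y"
  shows "x = y"
proof -
  obtain C where C: "vs.independent C" "vs.span C = V"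
    using vs.basis_exists[of V] vs.span_minimal[OF _ subspace] by (metis subset_antisym)
  have "vs.representation C x = vs.representation C y"
  proof
    fix b
    have "(\<lambda>z. if z \<in> V then vs.representation C z b else 0) \<in> dual L"
      by (rule dualI) (simp_all add: C vs.representation_add[OF C(1)]
          vs.representation_scale[OF C(1)])
    from eq[OF this] show "vs.representation C x b = vs.representation C y b"
      using assms by simp
  qed
  moreover have "(\<Sum>b | vs.representation C z b \<noteq> 0. sc (vs.representation C z b) b) = z"
    if "z \<in> V" for z
    using vs.sum_nonzero_representation_eq[OF C(1)] that C(2) by blast
  ultimately show ?thesis
    using assms(1,2) by metis
qed

end

text \<open>
  The decomposition that enters the definition of lifts does not depend on the map that is lifted.
  Therefore lifts commute with evaluation, sums and linear maps for arbitrary, not only for bilinear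
  arguments.
\<close>

definition decomposition :: "('k::field, 'a::ab_group_add) lie \<Rightarrow> ('k, 'a) tensor2 \<Rightarrow> ('a \<times> 'a) list"
  where "decomposition L t =
    (SOME ps. set ps \<subseteq> lie_set L \<times> lie_set L \<and> t = (\<Sum>(x, y)\<leftarrow>ps. tensor L x y))"

lemma tlift_decomposition: "tlift L f t = (\<Sum>(x, y)\<leftarrow>decomposition L t. f x y)"
  by (simp add: tlift_def decomposition_def)

lemma tlift_fun_apply: "tlift L f t a = tlift L (\<lambda>x y. f x y a) t"
  by (simp add: tlift_decomposition sum_list_fun_apply case_prod_unfold)

lemma decomposition:
  assumes "t \<in> tensor_space L"
  shows "set (decomposition L t) \<subseteq> lie_set L \<times> lie_set L"
    and "t = (\<Sum>(x, y)\<leftarrow>decomposition L t. tensor L x y)"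
proof -
  have "\<exists>ps. set ps \<subseteq> lie_set L \<times> lie_set L \<and> t = (\<Sum>(x, y)\<leftarrow>ps. tensor L x y)"
    using assms by (auto simp: tensor_space_def)
  from someI_ex[OF this] show "set (decomposition L t) \<subseteq> lie_set L \<times> lie_set L"
    and "t = (\<Sum>(x, y)\<leftarrow>decomposition L t. tensor L x y)"
    unfolding decomposition_def by blast+
qed

lemma sum_list_cong_pairs:
  assumes "set ps \<subseteq> A \<times> B" "\<And>x y. x \<in> A \<Longrightarrow> y \<in> B \<Longrightarrow> f x y = g x y"
  shows "(\<Sum>(x, y)\<leftarrow>ps. f x y) = (\<Sum>(x, y)\<leftarrow>ps. g x y)"
  by (rule arg_cong[where f = sum_list], rule map_cong) (use assms in auto)

lemma tlift_cong:
  assumes "t \<in> tensor_space L"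
    and "\<And>x y. x \<in> lie_set L \<Longrightarrow> y \<in> lie_set L \<Longrightarrow> f x y = g x y"
  shows "tlift L f t = tlift L g t"
  unfolding tlift_decomposition
  using decomposition(1)[OF assms(1)] assms(2) by (rule sum_list_cong_pairs)

lemma tlift_mem:
  assumes "t \<in> tensor_space L"
    and "\<And>x y. x \<in> lie_set L \<Longrightarrow> y \<in> lie_set L \<Longrightarrow> f x y \<in> T"
    and "0 \<in> T" "\<And>u v. u \<in> T \<Longrightarrow> v \<in> T \<Longrightarrow> u + v \<in> T"
  shows "tlift L f t \<in> T"
proof -
  have "(\<Sum>(x, y)\<leftarrow>ps. f x y) \<in> T" if "set ps \<subseteq> lie_set L \<times> lie_set L" for ps
    using that by (induction ps) (use assms in auto)
  then show ?thesis
    using decomposition(1)[OF assms(1)] by (simp add: tlift_decomposition)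
qed

lemma tlift_add: "tlift L (\<lambda>x y. f x y + g x y) t = tlift L f t + tlift L g t"
  unfolding tlift_decomposition by (simp add: sum_list_addf case_prod_unfold)

lemma tlift_diff: "tlift L (\<lambda>x y. f x y - g x y) t = tlift L f t - tlift L g t"
  unfolding tlift_decomposition by (simp add: sum_list_subtractf case_prod_unfold)

text \<open>Evaluation of a tensor at a pair of functionals is the lift of their product; together
  with the evaluation of lifts at functionals, this computes all the lifts that occur below.\<close>

lemma tlift_product:
  assumes t: "t \<in> tensor_space L" and "\<xi> \<in> dual L" "\<eta> \<in> dual L"
    and f: "\<And>x y. x \<in> lie_set L \<Longrightarrow> y \<in> lie_set L \<Longrightarrow> f x y = c * (\<xi> x * \<eta> y)"
  shows "tlift L f t = c * t \<xi> \<eta>"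
proof -
  have "t \<xi> \<eta> = (\<Sum>(x, y)\<leftarrow>decomposition L t. tensor L x y) \<xi> \<eta>"
    using decomposition(2)[OF t] by simp
  also have "\<dots> = (\<Sum>(x, y)\<leftarrow>decomposition L t. \<xi> x * \<eta> y)"
    using assms by (simp add: sum_list_fun_apply case_prod_unfold tensor_def)
  finally have "c * t \<xi> \<eta> = tlift L (\<lambda>x y. c * (\<xi> x * \<eta> y)) t"
    by (simp add: tlift_decomposition sum_list_const_mult case_prod_unfold)
  also have "\<dots> = tlift L f t"
    by (rule tlift_cong[OF t]) (simp add: f)
  finally show ?thesis by simp
qed

lemma tensor_outside:
  assumes "t \<in> tensor_space L" "\<xi> \<notin> dual L \<or> \<eta> \<notin> dual L"
  shows "t \<xi> \<eta> = 0"
proof -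
  have "t \<xi> \<eta> = (\<Sum>(x, y)\<leftarrow>decomposition L t. tensor L x y) \<xi> \<eta>"
    using decomposition(2)[OF assms(1)] by simp
  also have "\<dots> = (\<Sum>(x, y)\<leftarrow>decomposition L t. 0)"
    using assms(2) by (auto simp add: sum_list_fun_apply case_prod_unfold tensor_def)
  finally show ?thesis by (simp add: case_prod_unfold)
qed

lemma tensor_eqI:
  assumes "t \<in> tensor_space L" "u \<in> tensor_space L"
    and "\<And>\<xi> \<eta>. \<xi> \<in> dual L \<Longrightarrow> \<eta> \<in> dual L \<Longrightarrow> t \<xi> \<eta> = u \<xi> \<eta>"
  shows "t = u"
proof (intro ext)
  show "t \<xi> \<eta> = u \<xi> \<eta>" for \<xi> \<eta>
    using assms(3) tensor_outside[OF assms(1)] tensor_outside[OF assms(2)]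
    by (cases "\<xi> \<in> dual L \<and> \<eta> \<in> dual L") auto
qed

context lie_alg
begin

lemma tensor_space_0 [simp]: "0 \<in> tensor_space L"
  unfolding tensor_space_def by (auto intro: exI[of _ "[]"])

lemma tensor_in_space [simp]: "x \<in> V \<Longrightarrow> y \<in> V \<Longrightarrow> tensor L x y \<in> tensor_space L"
  unfolding tensor_space_def by (auto intro!: exI[of _ "[(x, y)]"])

lemma tensor_space_add [simp]:
  assumes "t \<in> tensor_space L" "u \<in> tensor_space L"
  shows "t + u \<in> tensor_space L"
proof -
  obtain ps qs where "set ps \<subseteq> V \<times> V" "set qs \<subseteq> V \<times> V"
    "t = (\<Sum>(x, y)\<leftarrow>ps. tensor L x y)" "u = (\<Sum>(x, y)\<leftarrow>qs. tensor L x y)"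
    using assms by (auto simp: tensor_space_def)
  then show ?thesis
    unfolding tensor_space_def by (auto intro!: exI[of _ "ps @ qs"])
qed

lemma tlift_closed:
  assumes "t \<in> tensor_space M"
    and "\<And>x y. x \<in> lie_set M \<Longrightarrow> y \<in> lie_set M \<Longrightarrow> f x y \<in> tensor_space L"
  shows "tlift M f t \<in> tensor_space L"
  by (rule tlift_mem[OF assms]) auto

lemma tensor_minus: "x \<in> V \<Longrightarrow> - tensor L x y = tensor L (- x) y"
  by (auto simp: tensor_def fun_eq_iff)

lemma tensor_space_minus [simp]:
  assumes "t \<in> tensor_space L"
  shows "- t \<in> tensor_space L"
proof -
  have "- t = tlift L (\<lambda>x y. tensor L (- x) y) t"
  proof -
    have "- t = - (\<Sum>(x, y)\<leftarrow>decomposition L t. tensor L x y)"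
      using decomposition(2)[OF assms] by simp
    also have "\<dots> = (\<Sum>(x, y)\<leftarrow>decomposition L t. - tensor L x y)"
      by (simp add: uminus_sum_list_map o_def case_prod_unfold)
    also have "\<dots> = (\<Sum>(x, y)\<leftarrow>decomposition L t. tensor L (- x) y)"
      using decomposition(1)[OF assms] by (rule sum_list_cong_pairs) (simp add: tensor_minus)
    finally show ?thesis by (simp add: tlift_decomposition)
  qed
  also have "\<dots> \<in> tensor_space L"
    by (rule tlift_closed[OF assms]) simp
  finally show ?thesis .
qed

lemma tensor_space_diff [simp]:
  "t \<in> tensor_space L \<Longrightarrow> u \<in> tensor_space L \<Longrightarrow> t - u \<in> tensor_space L"
  by (metis tensor_space_add tensor_space_minus add_uminus_conv_diff)

lemma tensor_space_sum [simp]: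
  "(\<And>i. i \<in> I \<Longrightarrow> t i \<in> tensor_space L) \<Longrightarrow> sum t I \<in> tensor_space L"
  by (induction I rule: infinite_finite_induct) (simp_all del: plus_fun_apply)

lemma flip_tensor_closed [simp]: "t \<in> tensor_space L \<Longrightarrow> flip_tensor L t \<in> tensor_space L"
  unfolding flip_tensor_def by (rule tlift_closed) auto

lemma ad2_closed [simp]: "x \<in> V \<Longrightarrow> t \<in> tensor_space L \<Longrightarrow> ad2 L x t \<in> tensor_space L"
  unfolding ad2_def by (rule tlift_closed) auto

lemma flip_tensor_apply [simp]:
  assumes "t \<in> tensor_space L" "\<xi> \<in> dual L" "\<eta> \<in> dual L"
  shows "flip_tensor L t \<xi> \<eta> = t \<eta> \<xi>"
  using tlift_product[OF assms(1,3,2), of "\<lambda>x y. tensor L y x \<xi> \<eta>" 1] assms(2,3)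
  by (simp add: flip_tensor_def tlift_fun_apply tensor_def)

lemma ad2_apply:
  assumes "t \<in> tensor_space L" "\<xi> \<in> dual L" "\<eta> \<in> dual L" "x \<in> V"
  shows "ad2 L x t \<xi> \<eta> = - t (coad L x \<xi>) \<eta> - t \<xi> (coad L x \<eta>)"
proof -
  have "tlift L (\<lambda>u v. tensor L (br x u) v \<xi> \<eta>) t = - 1 * t (coad L x \<xi>) \<eta>"
    by (rule tlift_product) (use assms brk_anticomm[of x] in \<open>auto simp: tensor_def\<close>)
  moreover have "tlift L (\<lambda>u v. tensor L u (br x v) \<xi> \<eta>) t = - 1 * t \<xi> (coad L x \<eta>)"
    by (rule tlift_product) (use assms brk_anticomm[of x] in \<open>auto simp: tensor_def\<close>)
  ultimately show ?thesis
    by (simp add: ad2_def tlift_fun_apply tlift_add)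
qed

end

lemma pointwise_apply: "pointwise f c g i = f c (g i)"
  by (simp add: pointwise_def)

lemma tlift_0 [simp]: "tlift L (\<lambda>x y. 0) t = 0"
  by (simp add: tlift_decomposition case_prod_unfold)

context lie_alg
begin

lemma dual_tlift:
  assumes "t \<in> tensor_space M" "\<eta> \<in> dual L"
    and "\<And>x y. x \<in> lie_set M \<Longrightarrow> y \<in> lie_set M \<Longrightarrow> f x y \<in> V"
  shows "\<eta> (tlift M f t) = tlift M (\<lambda>x y. \<eta> (f x y)) t"
proof -
  have "\<eta> (\<Sum>(x, y)\<leftarrow>ps. f x y) = (\<Sum>(x, y)\<leftarrow>ps. \<eta> (f x y)) \<and> (\<Sum>(x, y)\<leftarrow>ps. f x y) \<in> V"
    if "set ps \<subseteq> lie_set M \<times> lie_set M" for ps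
    using that by (induction ps) (use assms in auto)
  then show ?thesis
    using decomposition(1)[OF assms(1)] by (simp add: tlift_decomposition)
qed

lemma tensor_diff:
  assumes t: "t \<in> tensor_space L" and "\<xi> \<in> dual L" "\<xi>' \<in> dual L" "\<eta> \<in> dual L"
  shows "t (\<xi> - \<xi>') \<eta> = t \<xi> \<eta> - t \<xi>' \<eta>" "t \<eta> (\<xi> - \<xi>') = t \<eta> \<xi> - t \<eta> \<xi>'"
proof -
  have ev: "t \<alpha> \<beta> = tlift L (\<lambda>x y. \<alpha> x * \<beta> y) t" if "\<alpha> \<in> dual L" "\<beta> \<in> dual L" for \<alpha> \<beta>
    using tlift_product[OF t that, of "\<lambda>x y. \<alpha> x * \<beta> y" 1] by simp
  show "t (\<xi> - \<xi>') \<eta> = t \<xi> \<eta> - t \<xi>' \<eta>" "t \<eta> (\<xi> - \<xi>') = t \<eta> \<xi> - t \<eta> \<xi>'"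
    using assms by (simp_all add: ev tlift_diff left_diff_distrib right_diff_distrib)
qed

lemma tensor_space_scale:
  assumes t: "t \<in> tensor_space L"
  shows "pointwise (pointwise (*)) c t \<in> tensor_space L"
proof -
  have "pointwise (pointwise (*)) c t \<xi> \<eta> = tlift L (\<lambda>x y. tensor L (sc c x) y) t \<xi> \<eta>" for \<xi> \<eta>
  proof (cases "\<xi> \<in> dual L \<and> \<eta> \<in> dual L")
    case True
    then have "tlift L (\<lambda>x y. tensor L (sc c x) y \<xi> \<eta>) t = c * t \<xi> \<eta>"
      by (intro tlift_product[OF t]) (auto simp: tensor_def)
    then show ?thesis by (simp add: pointwise_def tlift_fun_apply)
  next
    case False
    then have "tensor L (sc c x) y \<xi> \<eta> = 0" for x y by (auto simp: tensor_def)
    then show ?thesis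
      using tensor_outside[OF t, of \<xi> \<eta>] False
      by (auto simp: pointwise_def tlift_fun_apply)
  qed
  then have "pointwise (pointwise (*)) c t = tlift L (\<lambda>x y. tensor L (sc c x) y) t"
    by (intro ext)
  also have "\<dots> \<in> tensor_space L" by (rule tlift_closed[OF t]) simp
  finally show ?thesis .
qed

text \<open>
  A skew tensor \<open>\<Sum>\<^sub>i x\<^sub>i \<otimes> y\<^sub>i\<close> is equal to \<open>\<Sum>\<^sub>i (x\<^sub>i / 2) \<and> y\<^sub>i\<close>, its own antisymmetrisation.
\<close>

lemma skew_tensor_in_wedge_space:
  assumes t: "t \<in> tensor_space L"
    and skew: "\<And>\<xi> \<eta>. \<xi> \<in> dual L \<Longrightarrow> \<eta> \<in> dual L \<Longrightarrow> t \<xi> \<eta> = - t \<eta> \<xi>"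
  shows "t \<in> wedge_space L"
proof -
  define u where "u = tlift L (\<lambda>x y. wedge L (sc (1/2) x) y) t"
  have "u \<in> tensor_space L"
    unfolding u_def by (rule tlift_closed[OF t]) (simp add: wedge_def)
  moreover have "u \<xi> \<eta> = t \<xi> \<eta>" if d: "\<xi> \<in> dual L" "\<eta> \<in> dual L" for \<xi> \<eta>
  proof -
    have "tlift L (\<lambda>x y. tensor L (sc (1/2) x) y \<xi> \<eta>) t = 1/2 * t \<xi> \<eta>"
      using d by (intro tlift_product[OF t]) (auto simp: tensor_def)
    moreover have "tlift L (\<lambda>x y. tensor L y (sc (1/2) x) \<xi> \<eta>) t = 1/2 * t \<eta> \<xi>"
      using d by (intro tlift_product[OF t]) (auto simp: tensor_def)
    ultimately have "u \<xi> \<eta> = 1/2 * t \<xi> \<eta> - 1/2 * t \<eta> \<xi>"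
      by (simp only: u_def wedge_def tlift_fun_apply tlift_diff minus_apply)
    then show ?thesis
      using skew[OF d] by simp
  qed
  ultimately have "t = u" using t by (metis tensor_eqI)
  moreover have "u \<in> wedge_space L"
    unfolding u_def
  proof (rule tlift_mem[OF t])
    show "wedge L (sc (1/2) x) y \<in> wedge_space L" if "x \<in> V" "y \<in> V" for x y
      using that unfolding wedge_space_def by (auto intro!: exI[of _ "[(sc (1/2) x, y)]"])
    show "0 \<in> wedge_space L"
      unfolding wedge_space_def by (auto intro: exI[of _ "[]"])
    fix u v assume "u \<in> wedge_space L" "v \<in> wedge_space L"
    then obtain ps qs where "set ps \<subseteq> V \<times> V" "set qs \<subseteq> V \<times> V"
      "u = (\<Sum>(x, y)\<leftarrow>ps. wedge L x y)" "v = (\<Sum>(x, y)\<leftarrow>qs. wedge L x y)"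
      by (auto simp: wedge_space_def)
    then show "u + v \<in> wedge_space L"
      unfolding wedge_space_def by (auto intro!: exI[of _ "ps @ qs"])
  qed
  ultimately show ?thesis by simp
qed

text \<open>
  The cocycle condition of a coboundary: the action of \<open>\<gg>\<close> on tensors is a representation. It is
  checked on functionals, where it becomes the statement for the coadjoint action.
\<close>

lemma ad2_brk:
  assumes t: "t \<in> tensor_space L" and xy: "x \<in> V" "y \<in> V"
  shows "ad2 L (br x y) t = ad2 L x (ad2 L y t) - ad2 L y (ad2 L x t)"
proof (rule tensor_eqI)
  fix \<xi> \<eta> assume d: "\<xi> \<in> dual L" "\<eta> \<in> dual L"
  have coad: "coad L (br x y) \<zeta> = coad L x (coad L y \<zeta>) - coad L y (coad L x \<zeta>)"
    if "\<zeta> \<in> dual L" for \<zeta>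
  proof (rule dual_eqI)
    fix z assume z: "z \<in> V"
    have "br z (br x y) = br (br z x) y - br (br z y) x"
      using brk_jacobi[of z x y] brk_anticomm[of "br z y" x] z xy by simp
    then show "coad L (br x y) \<zeta> z = (coad L x (coad L y \<zeta>) - coad L y (coad L x \<zeta>)) z"
      using that xy z by simp
  qed (use that xy in simp_all)
  show "ad2 L (br x y) t \<xi> \<eta> = (ad2 L x (ad2 L y t) - ad2 L y (ad2 L x t)) \<xi> \<eta>"
    using t xy d by (simp add: ad2_apply coad tensor_diff)
qed (use t xy in simp_all)

end


section \<open>The maps attached to a tensor\<close>

locale lie_tensor = lie_alg L
  for L :: "('k::field_char_0, 'a::ab_group_add) lie" +
  fixes r :: "('k, 'a) tensor2"
  assumes tensor: "r \<in> tensor_space L"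
begin

abbreviation p where "p \<equiv> r_plus L r"
abbreviation q where "q \<equiv> r_minus L r"
abbreviation s where "s \<xi> \<equiv> p \<xi> - q \<xi>"

lemma r_maps_closed [simp]: "p \<xi> \<in> V" "q \<xi> \<in> V"
proof -
  show "p \<xi> \<in> V"
    unfolding r_plus_def by (rule tlift_mem[OF tensor]) auto
  have "tlift L (\<lambda>x y. sc (\<xi> y) x) r \<in> V"
    by (rule tlift_mem[OF tensor]) auto
  then show "q \<xi> \<in> V" by (simp add: r_minus_def)
qed

lemma dual_r_plus:
  assumes "\<xi> \<in> dual L" "\<eta> \<in> dual L"
  shows "\<eta> (p \<xi>) = r \<xi> \<eta>"
  using tlift_product[OF tensor assms, of "\<lambda>x y. \<eta> (sc (\<xi> x) y)" 1] assms
  by (simp add: r_plus_def dual_tlift[OF tensor])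

lemma dual_r_minus:
  assumes "\<xi> \<in> dual L" "\<eta> \<in> dual L"
  shows "\<xi> (q \<eta>) = - r \<xi> \<eta>"
proof -
  have "tlift L (\<lambda>x y. sc (\<eta> y) x) r \<in> V"
    by (rule tlift_mem[OF tensor]) auto
  then show ?thesis
    using tlift_product[OF tensor assms, of "\<lambda>x y. \<xi> (sc (\<eta> y) x)" 1] assms
    by (simp add: r_minus_def dual_tlift[OF tensor])
qed

lemma r_maps_add [simp]: "p (\<xi> + \<eta>) = p \<xi> + p \<eta>" "q (\<xi> + \<eta>) = q \<xi> + q \<eta>"
  by (simp_all add: r_plus_def r_minus_def vs.scale_left_distrib tlift_add)

lemma r_maps_diff [simp]: "p (\<xi> - \<eta>) = p \<xi> - p \<eta>" "q (\<xi> - \<eta>) = q \<xi> - q \<eta>"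
  by (simp_all add: r_plus_def r_minus_def vs.scale_left_diff_distrib tlift_diff)

lemma r_maps_0 [simp]: "p 0 = 0" "q 0 = 0"
  using r_maps_diff[of 0 0] by simp_all

lemma r_maps_scale [simp]:
  assumes "\<xi> \<in> dual L"
  shows "p (pointwise (*) c \<xi>) = sc c (p \<xi>)" "q (pointwise (*) c \<xi>) = sc c (q \<xi>)"
proof -
  have c\<xi>: "pointwise (*) c \<xi> \<in> dual L" using assms by simp
  show "p (pointwise (*) c \<xi>) = sc c (p \<xi>)"
  proof (rule dual_separates)
    fix \<eta> assume \<eta>: "\<eta> \<in> dual L"
    have "\<eta> (p (pointwise (*) c \<xi>)) = - (pointwise (*) c \<xi>) (q \<eta>)"
      by (simp add: dual_r_plus dual_r_minus \<eta> c\<xi> del: dual_closed)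
    also have "\<dots> = c * \<eta> (p \<xi>)"
      by (simp add: pointwise_def dual_r_plus dual_r_minus \<eta> assms)
    finally show "\<eta> (p (pointwise (*) c \<xi>)) = \<eta> (sc c (p \<xi>))" using \<eta> by simp
  qed simp_all
  show "q (pointwise (*) c \<xi>) = sc c (q \<xi>)"
  proof (rule dual_separates)
    fix \<eta> assume \<eta>: "\<eta> \<in> dual L"
    have "\<eta> (q (pointwise (*) c \<xi>)) = - (pointwise (*) c \<xi>) (p \<eta>)"
      by (simp add: dual_r_plus dual_r_minus \<eta> c\<xi> del: dual_closed)
    also have "\<dots> = c * \<eta> (q \<xi>)"
      by (simp add: pointwise_def dual_r_plus dual_r_minus \<eta> assms)
    finally show "\<eta> (q (pointwise (*) c \<xi>)) = \<eta> (sc c (q \<xi>))" using \<eta> by simp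
  qed simp_all
qed

lemma ad2_r:
  assumes "\<xi> \<in> dual L" "\<eta> \<in> dual L" "x \<in> V"
  shows "ad2 L x r \<xi> \<eta> = \<eta> (br x (p \<xi>)) - \<xi> (br x (q \<eta>))"
proof -
  have "r (coad L x \<xi>) \<eta> = - \<xi> (br (q \<eta>) x)" "r \<xi> (coad L x \<eta>) = \<eta> (br (p \<xi>) x)"
    using dual_r_minus[of "coad L x \<xi>" \<eta>] dual_r_plus[of \<xi> "coad L x \<eta>"] assms by simp_all
  moreover have "br x (q \<eta>) = - br (q \<eta>) x" "br x (p \<xi>) = - br (p \<xi>) x"
    using assms by (intro brk_anticomm; simp)+
  ultimately show ?thesis
    using assms by (simp add: ad2_apply tensor)
qed

lemma ad2_sym_part:
  assumes d: "\<xi> \<in> dual L" "\<eta> \<in> dual L" and x: "x \<in> V"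
  shows "ad2 L x (sym_part L r) \<xi> \<eta> = 1/2 * (\<eta> (br x (s \<xi>)) + \<xi> (br x (s \<eta>)))"
proof -
  have sym: "sym_part L r \<alpha> \<beta> = 1/2 * (r \<alpha> \<beta> + r \<beta> \<alpha>)" if "\<alpha> \<in> dual L" "\<beta> \<in> dual L" for \<alpha> \<beta>
    using that tensor by (simp add: sym_part_def pointwise_def)
  have "sym_part L r \<in> tensor_space L"
    unfolding sym_part_def using tensor by (simp add: tensor_space_scale)
  then have "ad2 L x (sym_part L r) \<xi> \<eta> = 1/2 * (ad2 L x r \<xi> \<eta> + ad2 L x r \<eta> \<xi>)"
    using d x tensor by (simp add: ad2_apply sym algebra_simps)
  then show ?thesis
    using d x by (simp add: ad2_r algebra_simps)
qed

lemma yang_baxter_outside: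
  assumes "\<xi> \<notin> dual L \<or> \<eta> \<notin> dual L \<or> \<theta> \<notin> dual L"
  shows "yang_baxter L r \<xi> \<eta> \<theta> = 0"
proof -
  have "tensor3 L x y z \<xi> \<eta> \<theta> = 0" for x y z
    using assms by (auto simp: tensor3_def)
  then show ?thesis
    by (simp add: yang_baxter_def tlift_fun_apply)
qed

text \<open>
  Each of the three terms is contracted twice: the inner lift pairs one copy of \<open>r\<close> with two
  functionals, one of them moved by the coadjoint action, and the outer lift does the same with the
  other copy.
\<close>

lemma yang_baxter_apply:
  assumes d: "\<xi> \<in> dual L" "\<eta> \<in> dual L" "\<theta> \<in> dual L"
  shows "yang_baxter L r \<xi> \<eta> \<theta> =
    \<xi> (br (q \<eta>) (q \<theta>)) - \<eta> (br (p \<xi>) (q \<theta>)) + \<theta> (br (p \<xi>) (p \<eta>))"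
proof -
  have r_coad: "r (coad L x \<alpha>) \<beta> = - \<alpha> (br (q \<beta>) x)" "r \<beta> (coad L x \<alpha>) = \<alpha> (br (p \<beta>) x)"
    if "\<alpha> \<in> dual L" "\<beta> \<in> dual L" "x \<in> V" for x \<alpha> \<beta>
    using dual_r_minus[of "coad L x \<alpha>" \<beta>] dual_r_plus[of \<beta> "coad L x \<alpha>"] that by simp_all
  have anti: "\<alpha> (br x y) = - \<alpha> (br y x)" if "\<alpha> \<in> dual L" "x \<in> V" "y \<in> V" for \<alpha> x y
    using that by (subst brk_anticomm) simp_all
  have 1: "tlift L (\<lambda>x y. tlift L (\<lambda>x' y'. tensor3 L (br x x') y y' \<xi> \<eta> \<theta>) r) r
      = -1 * r (coad L (q \<theta>) \<xi>) \<eta>"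
  proof (rule tlift_product[OF tensor])
    fix x y assume xy: "x \<in> V" "y \<in> V"
    have "tlift L (\<lambda>x' y'. tensor3 L (br x x') y y' \<xi> \<eta> \<theta>) r = - \<eta> y * r (coad L x \<xi>) \<theta>"
      using d xy by (intro tlift_product[OF tensor]) (auto simp: tensor3_def anti[of _ x])
    then show "tlift L (\<lambda>x' y'. tensor3 L (br x x') y y' \<xi> \<eta> \<theta>) r
        = -1 * (coad L (q \<theta>) \<xi> x * \<eta> y)"
      using d xy by (simp add: r_coad anti[of \<xi> x])
  qed (use d in simp_all)
  have 2: "tlift L (\<lambda>x y. tlift L (\<lambda>x' y'. tensor3 L x (br y x') y' \<xi> \<eta> \<theta>) r) r
      = -1 * r \<xi> (coad L (q \<theta>) \<eta>)"
  proof (rule tlift_product[OF tensor])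
    fix x y assume xy: "x \<in> V" "y \<in> V"
    have "tlift L (\<lambda>x' y'. tensor3 L x (br y x') y' \<xi> \<eta> \<theta>) r = - \<xi> x * r (coad L y \<eta>) \<theta>"
      using d xy by (intro tlift_product[OF tensor]) (auto simp: tensor3_def anti[of _ y])
    then show "tlift L (\<lambda>x' y'. tensor3 L x (br y x') y' \<xi> \<eta> \<theta>) r
        = -1 * (\<xi> x * coad L (q \<theta>) \<eta> y)"
      using d xy by (simp add: r_coad anti[of \<eta> y])
  qed (use d in simp_all)
  have 3: "tlift L (\<lambda>x y. tlift L (\<lambda>x' y'. tensor3 L x x' (br y y') \<xi> \<eta> \<theta>) r) r
      = 1 * r \<xi> (coad L (p \<eta>) \<theta>)"
  proof (rule tlift_product[OF tensor])
    fix x y assume xy: "x \<in> V" "y \<in> V"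
    have "tlift L (\<lambda>x' y'. tensor3 L x x' (br y y') \<xi> \<eta> \<theta>) r = - \<xi> x * r \<eta> (coad L y \<theta>)"
      using d xy by (intro tlift_product[OF tensor]) (auto simp: tensor3_def anti[of _ y])
    then show "tlift L (\<lambda>x' y'. tensor3 L x x' (br y y') \<xi> \<eta> \<theta>) r
        = 1 * (\<xi> x * coad L (p \<eta>) \<theta> y)"
      using d xy by (simp add: r_coad anti[of \<theta> y])
  qed (use d in simp_all)
  show ?thesis
    using d 1 2 3 by (simp add: yang_baxter_def tlift_fun_apply r_coad)
qed

text \<open>
  A tensor is zero as soon as it vanishes at all functionals, so both conditions become identities
  between \<open>p\<close>, \<open>q\<close> and the bracket. The factor \<open>1/2\<close> in the symmetric part is invertible in
  characteristic \<open>0\<close>.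
\<close>

lemma quasitriangular_iff:
  "quasitriangular L r \<longleftrightarrow>
     (\<forall>x\<in>V. \<forall>\<xi>\<in>dual L. \<forall>\<eta>\<in>dual L. \<eta> (br x (s \<xi>)) + \<xi> (br x (s \<eta>)) = 0) \<and>
     (\<forall>\<xi>\<in>dual L. \<forall>\<eta>\<in>dual L. \<forall>\<theta>\<in>dual L.
        \<xi> (br (q \<eta>) (q \<theta>)) - \<eta> (br (p \<xi>) (q \<theta>)) + \<theta> (br (p \<xi>) (p \<eta>)) = 0)"
    (is "_ \<longleftrightarrow> ?inv \<and> ?ybe")
proof -
  have sym: "sym_part L r \<in> tensor_space L"
    unfolding sym_part_def using tensor by (simp add: tensor_space_scale)
  have "ad2 L x (sym_part L r) = 0 \<longleftrightarrow>
      (\<forall>\<xi>\<in>dual L. \<forall>\<eta>\<in>dual L. \<eta> (br x (s \<xi>)) + \<xi> (br x (s \<eta>)) = 0)" if x: "x \<in> V" for x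
  proof
    assume "ad2 L x (sym_part L r) = 0"
    then show "\<forall>\<xi>\<in>dual L. \<forall>\<eta>\<in>dual L. \<eta> (br x (s \<xi>)) + \<xi> (br x (s \<eta>)) = 0"
      using ad2_sym_part x by (metis (no_types, lifting) mult_eq_0_iff zero_fun_apply
          divide_eq_0_iff zero_neq_numeral zero_neq_one)
  next
    assume "\<forall>\<xi>\<in>dual L. \<forall>\<eta>\<in>dual L. \<eta> (br x (s \<xi>)) + \<xi> (br x (s \<eta>)) = 0"
    then show "ad2 L x (sym_part L r) = 0"
      using sym x by (intro tensor_eqI[of _ L]) (simp_all only: tensor_space_0 ad2_closed
          ad2_sym_part zero_fun_apply mult_zero_right)
  qed
  moreover have "yang_baxter L r = 0 \<longleftrightarrow> ?ybe"
  proof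
    assume "yang_baxter L r = 0"
    then show ?ybe using yang_baxter_apply by (metis zero_fun_apply)
  next
    assume ybe: ?ybe
    show "yang_baxter L r = 0"
    proof (intro ext)
      show "yang_baxter L r \<xi> \<eta> \<theta> = 0 \<xi> \<eta> \<theta>" for \<xi> \<eta> \<theta>
      proof (cases "\<xi> \<in> dual L \<and> \<eta> \<in> dual L \<and> \<theta> \<in> dual L")
        case True
        then show ?thesis using ybe by (simp add: yang_baxter_apply)
      next
        case False
        then show ?thesis using yang_baxter_outside by simp
      qed
    qed
  qed
  ultimately show ?thesis
    using lie tensor by (auto simp: quasitriangular_def)
qed

end



section \<open>Quasitriangular structures define Lie bialgebras\<close>

locale quasitriangular_lie = lie_tensor L r
  for L :: "('k::field_char_0, 'a::ab_group_add) lie" and r +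
  assumes quasitriangular: "quasitriangular L r"
begin

abbreviation bracket where "bracket \<equiv> dual_bracket L (cobracket L r)"

lemma invariance:
  assumes "\<xi> \<in> dual L" "\<eta> \<in> dual L" "x \<in> V"
  shows "\<xi> (br x (s \<eta>)) = - \<eta> (br x (s \<xi>))"
  using quasitriangular assms unfolding quasitriangular_iff by (metis eq_neg_iff_add_eq_0)

lemma yang_baxter:
  assumes "\<xi> \<in> dual L" "\<eta> \<in> dual L" "\<theta> \<in> dual L"
  shows "\<xi> (br (q \<eta>) (q \<theta>)) - \<eta> (br (p \<xi>) (q \<theta>)) + \<theta> (br (p \<xi>) (p \<eta>)) = 0"
  using quasitriangular assms unfolding quasitriangular_iff by blast

lemma bracket_apply:
  assumes "\<xi> \<in> dual L" "\<eta> \<in> dual L" "x \<in> V"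
  shows "bracket \<xi> \<eta> x = \<eta> (br x (p \<xi>)) - \<xi> (br x (q \<eta>))"
  using assms by (simp add: dual_bracket_def cobracket_def ad2_r)

lemma bracket_in_dual [simp]:
  assumes "\<xi> \<in> dual L" "\<eta> \<in> dual L"
  shows "bracket \<xi> \<eta> \<in> dual L"
  using assms by (intro dualI)
    (simp_all add: bracket_apply algebra_simps, simp add: dual_bracket_def)

text \<open>
  At \<open>x\<close>, \<open>[\<xi>, \<eta>] + [\<eta>, \<xi>]\<close> is \<open>\<langle>\<eta>, [x, s \<xi>]\<rangle> + \<langle>\<xi>, [x, s \<eta>]\<rangle>\<close>, which vanishes by invariance.
\<close>

lemma bracket_skew:
  assumes "\<xi> \<in> dual L" "\<eta> \<in> dual L" "x \<in> V"
  shows "bracket \<xi> \<eta> x = - bracket \<eta> \<xi> x"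
  using invariance[OF assms] assms by (simp add: bracket_apply algebra_simps)

text \<open>
  The map \<open>q\<close> is dual to \<open>- p\<close>, and \<open>[\<xi>, \<eta>]\<close> is skew; so the value of \<open>q [\<xi>, \<eta>]\<close> at \<open>\<theta>\<close> is
  that of \<open>[\<eta>, \<xi>]\<close> at \<open>p \<theta>\<close>. Its two terms are two of the terms of the Yang-Baxter equation at
  \<open>(\<theta>, \<eta>, \<xi>)\<close>.
\<close>

lemma r_minus_bracket:
  assumes d: "\<xi> \<in> dual L" "\<eta> \<in> dual L"
  shows "q (bracket \<xi> \<eta>) = br (q \<xi>) (q \<eta>)"
proof (rule dual_separates)
  fix \<theta> assume \<theta>: "\<theta> \<in> dual L"
  have "\<theta> (q (bracket \<xi> \<eta>)) = bracket \<eta> \<xi> (p \<theta>)"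
    using d \<theta> bracket_skew[of \<xi> \<eta> "p \<theta>"] dual_r_plus[of \<theta> "bracket \<xi> \<eta>"] by (simp add: dual_r_minus)
  also have "\<dots> = \<xi> (br (p \<theta>) (p \<eta>)) - \<eta> (br (p \<theta>) (q \<xi>))"
    using d \<theta> by (simp add: bracket_apply)
  also have "\<dots> = - \<theta> (br (q \<eta>) (q \<xi>))"
    using yang_baxter[OF \<theta> d(2,1)] by algebra
  also have "\<dots> = \<theta> (br (q \<xi>) (q \<eta>))"
    using \<theta> brk_anticomm[of "q \<eta>" "q \<xi>"] by simp
  finally show "\<theta> (q (bracket \<xi> \<eta>)) = \<theta> (br (q \<xi>) (q \<eta>))" .
qed simp_all

text \<open>
  As \<open>s\<close> is symmetric, invariance moves \<open>ad\<^sub>x\<close> from its value to its argument.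
\<close>

lemma s_coad:
  assumes "\<xi> \<in> dual L" "x \<in> V"
  shows "s (coad L x \<xi>) = br x (s \<xi>)"
proof (rule dual_separates)
  fix \<eta> assume \<eta>: "\<eta> \<in> dual L"
  have s_sym: "\<alpha> (s \<beta>) = \<beta> (s \<alpha>)" if "\<alpha> \<in> dual L" "\<beta> \<in> dual L" for \<alpha> \<beta>
    using that by (simp add: dual_r_plus dual_r_minus)
  have "\<eta> (s (coad L x \<xi>)) = \<xi> (br (s \<eta>) x)"
    using s_sym[of \<eta> "coad L x \<xi>"] \<eta> assms by simp
  also have "\<dots> = - \<xi> (br x (s \<eta>))"
    using brk_anticomm[of "s \<eta>" x] assms by simp
  also have "\<dots> = \<eta> (br x (s \<xi>))"
    using invariance[of \<xi> \<eta> x] \<eta> assms by simp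
  finally show "\<eta> (s (coad L x \<xi>)) = \<eta> (br x (s \<xi>))" .
qed (use assms in simp_all)

text \<open>
  The outer \<open>ad\<^sub>x\<close> is moved to \<open>\<theta>\<close>, invariance exchanges the two functionals, and the previous lemma moves
  \<open>ad\<^sub>x\<close> back inside. By this rule \<open>s\<close> changes its partner across two nested brackets, which makes the
  terms of the Jacobi identity cancel.
\<close>

lemma s_exchange:
  assumes "\<theta> \<in> dual L" "\<eta> \<in> dual L" "x \<in> V" "z \<in> V"
  shows "\<theta> (br x (br z (s \<eta>))) = \<eta> (br z (br x (s \<theta>)))"
proof -
  have "\<theta> (br x (br z (s \<eta>))) = - coad L x \<theta> (br z (s \<eta>))"
    using assms brk_anticomm[of x "br z (s \<eta>)"] by (simp del: brk_diff)
  also have "\<dots> = \<eta> (br z (s (coad L x \<theta>)))"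
    using invariance[of "coad L x \<theta>" \<eta> z] assms by simp
  also have "s (coad L x \<theta>) = br x (s \<theta>)"
    using assms by (intro s_coad)
  finally show ?thesis .
qed

text \<open>
  As \<open>q\<close> is a homomorphism, each double bracket expands to three terms. The nine terms are
  sorted by the functional that stands outside. With \<open>p = q + s\<close> and the Jacobi identity of \<open>\<gg>\<close>, the
  terms with no \<open>s\<close> cancel for each functional separately. What remains, called \<open>part\<close> below, is linear
  or quadratic in \<open>s\<close>, and it cancels in the cyclic sum by \<open>s_exchange\<close>.
\<close>

lemma bracket_jacobi:
  assumes d: "\<xi> \<in> dual L" "\<eta> \<in> dual L" "\<theta> \<in> dual L"
  shows "bracket \<xi> (bracket \<eta> \<theta>) + bracket \<eta> (bracket \<theta> \<xi>) + bracket \<theta> (bracket \<xi> \<eta>) = 0"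
proof (rule dual_eqI)
  fix x assume x: "x \<in> V"
  have expand: "bracket \<alpha> (bracket \<beta> \<gamma>) x
      = \<gamma> (br (br x (p \<alpha>)) (p \<beta>)) - \<beta> (br (br x (p \<alpha>)) (q \<gamma>)) - \<alpha> (br x (br (q \<beta>) (q \<gamma>)))"
    if "\<alpha> \<in> dual L" "\<beta> \<in> dual L" "\<gamma> \<in> dual L" for \<alpha> \<beta> \<gamma>
    using that x by (simp add: bracket_apply r_minus_bracket)
  define part where "part \<alpha> \<beta> \<gamma>
    = \<gamma> (br (br x (s \<alpha>)) (q \<beta>)) + \<gamma> (br x (br (q \<alpha>) (s \<beta>))) + \<gamma> (br (br x (s \<alpha>)) (s \<beta>))"
    for \<alpha> \<beta> \<gamma> :: "'a \<Rightarrow> 'k"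
  have part: "\<gamma> (br (br x (p \<alpha>)) (p \<beta>)) - \<gamma> (br (br x (p \<beta>)) (q \<alpha>))
      - \<gamma> (br x (br (q \<alpha>) (q \<beta>))) = part \<alpha> \<beta> \<gamma>"
    if "\<alpha> \<in> dual L" "\<beta> \<in> dual L" "\<gamma> \<in> dual L" for \<alpha> \<beta> \<gamma>
  proof -
    have j: "br x (br (q \<alpha>) (q \<beta>)) = br (br x (q \<alpha>)) (q \<beta>) - br (br x (q \<beta>)) (q \<alpha>)"
      "br x (br (q \<alpha>) (p \<beta>)) = br (br x (q \<alpha>)) (p \<beta>) - br (br x (p \<beta>)) (q \<alpha>)"
      using x brk_jacobi[of x "q \<alpha>" "q \<beta>"] brk_anticomm[of "q \<alpha>" "br x (q \<beta>)"]
        brk_jacobi[of x "q \<alpha>" "p \<beta>"] brk_anticomm[of "q \<alpha>" "br x (p \<beta>)"] by simp_all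
    show ?thesis
      using that x by (simp add: part_def j algebra_simps)
  qed
  have cancel: "\<gamma> (br x (br (q \<alpha>) (s \<beta>))) = - \<beta> (br (br x (s \<gamma>)) (q \<alpha>))"
    if "\<alpha> \<in> dual L" "\<beta> \<in> dual L" "\<gamma> \<in> dual L" for \<alpha> \<beta> \<gamma>
    using s_exchange[of \<gamma> \<beta> x "q \<alpha>"] brk_anticomm[of "q \<alpha>" "br x (s \<gamma>)"] that x
    by (simp del: brk_diff)
  have cubic: "\<theta> (br (br x (s \<xi>)) (s \<eta>)) + \<xi> (br (br x (s \<eta>)) (s \<theta>)) + \<eta> (br (br x (s \<theta>)) (s \<xi>)) = 0"
  proof -
    have "\<theta> (br x (br (s \<xi>) (s \<eta>))) = - \<eta> (br (br x (s \<theta>)) (s \<xi>))"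
      using s_exchange[of \<theta> \<eta> x "s \<xi>"] brk_anticomm[of "s \<xi>" "br x (s \<theta>)"] d x
      by (simp del: brk_diff)
    moreover have "br x (br (s \<xi>) (s \<eta>)) = br (br x (s \<xi>)) (s \<eta>) - br (br x (s \<eta>)) (s \<xi>)"
      using x brk_jacobi[of x "s \<xi>" "s \<eta>"] brk_anticomm[of "s \<xi>" "br x (s \<eta>)"] by (simp del: brk_diff)
    moreover have "\<theta> (br (br x (s \<eta>)) (s \<xi>)) = - \<xi> (br (br x (s \<eta>)) (s \<theta>))"
      using d x by (intro invariance) simp_all
    ultimately show ?thesis
      using d x by (simp del: brk_diff add: algebra_simps)
  qed
  have "part \<xi> \<eta> \<theta> + part \<eta> \<theta> \<xi> + part \<theta> \<xi> \<eta> = 0"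
    using d cubic by (simp add: part_def cancel algebra_simps del: brk_diff)
  then show "(bracket \<xi> (bracket \<eta> \<theta>) + bracket \<eta> (bracket \<theta> \<xi>) + bracket \<theta> (bracket \<xi> \<eta>)) x = 0 x"
    using d by (simp add: expand part[symmetric] algebra_simps)
qed (use d in simp_all)

lemma lie_bracket_dual: "lie_bracket (pointwise (*)) (dual L) bracket"
proof -
  have "bracket \<xi> \<xi> = 0" if "\<xi> \<in> dual L" for \<xi>
  proof (rule dual_eqI)
    show "bracket \<xi> \<xi> x = 0 x" if "x \<in> V" for x
      using bracket_skew[of \<xi> \<xi> x] that \<open>\<xi> \<in> dual L\<close> by simp
  qed (use that in simp_all)
  moreover have "bilinear_on (pointwise (*)) (dual L) (pointwise (*)) bracket"
    unfolding bilinear_on_def linear_on_def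
    by (intro conjI ballI allI; rule dual_eqI)
      (simp_all add: bracket_apply pointwise_apply algebra_simps)
  ultimately show ?thesis
    using bracket_jacobi by (simp add: lie_bracket_def)
qed

lemma lie_bialgebra: "lie_bialgebra L (cobracket L r)"
proof -
  have skew: "cobracket L r x \<in> wedge_space L" if "x \<in> V" for x
  proof (rule skew_tensor_in_wedge_space)
    show "cobracket L r x \<in> tensor_space L"
      using that tensor by (simp add: cobracket_def)
    show "cobracket L r x \<xi> \<eta> = - cobracket L r x \<eta> \<xi>" if "\<xi> \<in> dual L" "\<eta> \<in> dual L" for \<xi> \<eta>
      using bracket_skew[of \<xi> \<eta> x] that \<open>x \<in> V\<close> by (simp add: dual_bracket_def)
  qed
  have "linear_on sc V (pointwise (pointwise (*))) (cobracket L r)"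
    unfolding linear_on_def
  proof (intro conjI ballI allI)
    show "cobracket L r (x + y) = cobracket L r x + cobracket L r y" if "x \<in> V" "y \<in> V" for x y
      using that tensor
      by (intro tensor_eqI[of _ L]) (simp_all add: cobracket_def ad2_r algebra_simps)
    show "cobracket L r (sc c x) = pointwise (pointwise (*)) c (cobracket L r x)" if "x \<in> V" for c x
      using that tensor
      by (intro tensor_eqI[of _ L])
        (simp_all add: cobracket_def ad2_r tensor_space_scale
          pointwise_apply algebra_simps)
  qed
  with skew show ?thesis
    using lie lie_bracket_dual tensor by (simp add: lie_bialgebra_def ad2_brk cobracket_def)
qed

end

section \<open>Increments of potentials\<close>

context quasitriangular_lie
begin

text \<open>
  Below, \<open>u\<close> and \<open>v\<close> are the values of \<open>p\<close> at the totals of two tuples of functionals, and \<open>\<sigma>\<close>, \<open>\<tau>\<close> are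
  partial sums of these tuples.
\<close>

definition bracket_potential where
  "bracket_potential u v \<sigma> \<tau> x = \<tau> (br x u) - \<sigma> (br x (v - s \<tau>))"

text \<open>
  A discrete product rule. By invariance \<open>\<langle>\<sigma>, [x, s \<tau>]\<rangle>\<close> is skew, so its increment is the sum of two
  terms in which one argument is changed at a time; \<open>\<sigma>\<close> is taken at the beginning of the step and \<open>\<tau>\<close>
  at its end.
\<close>

lemma bracket_potential_difference:
  assumes d: "\<sigma> \<in> dual L" "\<tau> \<in> dual L" "\<sigma>' \<in> dual L" "\<tau>' \<in> dual L"
    and u: "u \<in> V" "v \<in> V" "x \<in> V"
  shows "(\<tau>' - \<tau>) (br x (u - s \<sigma>)) - (\<sigma>' - \<sigma>) (br x (v - s \<tau>'))
    = bracket_potential u v \<sigma>' \<tau>' x - bracket_potential u v \<sigma> \<tau> x"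
proof -
  have split: "\<alpha> (br x (z - s \<beta>)) = \<alpha> (br x z) - \<alpha> (br x (s \<beta>))"
    if "\<alpha> \<in> dual L" "\<beta> \<in> dual L" "z \<in> V" for \<alpha> \<beta> z
    using that u by simp
  note inv = invariance[OF d(4) d(1) u(3)] invariance[OF d(2) d(1) u(3)]
  show ?thesis
    unfolding bracket_potential_def minus_apply split[OF d(2) d(1) u(1)] split[OF d(4) d(1) u(1)]
      split[OF d(1) d(4) u(2)] split[OF d(3) d(4) u(2)] split[OF d(1) d(2) u(2)]
    using inv by algebra
qed

text \<open>
  This is the left hand side of the next lemma for the step from \<open>(0, 0, 0)\<close> to \<open>(\<alpha>, \<beta>, \<gamma>)\<close>. If \<open>u\<close>, \<open>v\<close>
  and \<open>w\<close> are the values of \<open>p\<close> at \<open>\<alpha>\<close>, \<open>\<beta>\<close> and \<open>\<gamma>\<close>, then \<open>v - s \<beta> = q \<beta>\<close> and \<open>w - s \<gamma> = q \<gamma>\<close>, and it is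
  the Yang-Baxter expression of \<open>r\<close>.
\<close>

definition yang_baxter_potential where
  "yang_baxter_potential u v w \<alpha> \<beta> \<gamma> =
    \<alpha> (br (v - s \<beta>) (w - s \<gamma>)) - \<beta> (br u (w - s \<gamma>)) + \<gamma> (br u v)"

text \<open>
  The cubic analogue. By invariance the form \<open>\<langle>\<xi>, [s \<eta>, s \<theta>]\<rangle>\<close> is alternating and the forms
  \<open>\<langle>\<xi>, [x, s \<eta>]\<rangle>\<close> are skew. Each of these forms contributes its increment, with one argument changed at a
  time.
\<close>

lemma yang_baxter_potential_difference:
  assumes d: "\<alpha> \<in> dual L" "\<beta> \<in> dual L" "\<gamma> \<in> dual L" "\<alpha>' \<in> dual L" "\<beta>' \<in> dual L" "\<gamma>' \<in> dual L"
    and u: "u \<in> V" "v \<in> V" "w \<in> V"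
  shows "(\<alpha>' - \<alpha>) (br (v - s \<beta>') (w - s \<gamma>')) - (\<beta>' - \<beta>) (br (u - s \<alpha>) (w - s \<gamma>'))
      + (\<gamma>' - \<gamma>) (br (u - s \<alpha>) (v - s \<beta>))
    = yang_baxter_potential u v w \<alpha>' \<beta>' \<gamma>' - yang_baxter_potential u v w \<alpha> \<beta> \<gamma>"
proof -
  define S where "S \<xi> = s \<xi>" for \<xi>
  have S: "S \<xi> \<in> V" for \<xi> by (simp add: S_def)
  have split: "\<xi> (br (y - S \<eta>) (z - S \<theta>))
      = \<xi> (br y z) - \<xi> (br y (S \<theta>)) + \<xi> (br z (S \<eta>)) + \<xi> (br (S \<eta>) (S \<theta>))"
    and split': "\<xi> (br y (z - S \<theta>)) = \<xi> (br y z) - \<xi> (br y (S \<theta>))"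
    if "\<xi> \<in> dual L" "y \<in> V" "z \<in> V" for \<xi> \<eta> \<theta> y z
    using that S brk_anticomm[of "S \<eta>" z] by simp_all
  have inv: "\<xi> (br x (S \<eta>)) = - \<eta> (br x (S \<xi>))" if "\<xi> \<in> dual L" "\<eta> \<in> dual L" "x \<in> V" for \<xi> \<eta> x
    using invariance[OF that] by (simp only: S_def)
  have cyc: "\<xi> (br (S \<eta>) (S \<theta>)) = \<theta> (br (S \<xi>) (S \<eta>))"
    if "\<xi> \<in> dual L" "\<eta> \<in> dual L" "\<theta> \<in> dual L" for \<xi> \<eta> \<theta>
    using inv[of \<xi> \<theta> "S \<eta>"] that S brk_anticomm[of "S \<eta>" "S \<xi>"] by simp
  note facts =
    inv[OF d(6) d(2) u(1)] inv[OF d(3) d(2) u(1)]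
    inv[OF d(6) d(1) u(2)] inv[OF d(3) d(1) u(2)]
    inv[OF d(5) d(1) u(3)] inv[OF d(2) d(1) u(3)]
    cyc[OF d(1,5,6)] cyc[OF d(1,2,3)] inv[OF d(5,6) S[of \<alpha>]] inv[OF d(2,6) S[of \<alpha>]]
  show ?thesis
    unfolding yang_baxter_potential_def minus_apply S_def[symmetric]
    using facts by (simp only: split split' d u S) (simp add: algebra_simps)
qed

end



section \<open>Direct powers\<close>

lemma sum_fun_apply: "(\<Sum>i\<in>I. f i) x = (\<Sum>i\<in>I. f i x)"
  by (induction I rule: infinite_finite_induct) auto

lemma lie_power_simps [simp]:
  "lie_set (lie_power L n) = tuples n (lie_set L)"
  "scl (lie_power L n) = pointwise (scl L)"
  "brk (lie_power L n) x y i = (if i \<in> {1..n} then brk L (x i) (y i) else 0)"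
  by (simp_all add: lie_power_def)

context lie_alg
begin

lemma tuples_iff: "x \<in> tuples n V \<longleftrightarrow> (\<forall>i. x i \<in> V) \<and> (\<forall>i. i \<notin> {1..n} \<longrightarrow> x i = 0)"
  unfolding tuples_def using closed(1) by fastforce

lemma tuples_apply [simp]: "x \<in> tuples n V \<Longrightarrow> x i \<in> V"
  by (simp add: tuples_iff)

lemma summand_in_tuples [simp]: "j \<in> {1..n} \<Longrightarrow> x \<in> V \<Longrightarrow> summand j x \<in> tuples n V"
  by (auto simp: tuples_iff summand_def)

lemma fin_dim_power: "fin_dim_space (pointwise sc) (tuples n V)"
proof -
  interpret pw: vector_space "pointwise sc"
    by unfold_locales
      (simp_all add: pointwise_def fun_eq_iff vs.scale_right_distrib vs.scale_left_distrib)
  obtain B where B: "finite B" "vs.span B = V"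
    using lie by (auto simp: lie_algebra_def fin_dim_space_def)
  define C where "C = (\<Union>j\<in>{1..n}. summand j ` B)"
  have "finite C" using B by (simp add: C_def)
  moreover have "pw.span C = tuples n V"
  proof
    have "pw.subspace (tuples n V)"
      by (rule pw.subspaceI) (auto simp: tuples_iff pointwise_def)
    moreover have "C \<subseteq> tuples n V"
      using vs.span_superset[of B] B(2) unfolding C_def by auto
    ultimately show "pw.span C \<subseteq> tuples n V" by (intro pw.span_minimal)
  next
    have single: "summand j v \<in> pw.span C" if j: "j \<in> {1..n}" and v: "v \<in> vs.span B" for j v
      using v
    proof (induction rule: vs.span_induct_alt)
      case base
      have "summand j (0 :: 'a) = 0" by (auto simp: summand_def)
      then show ?case using pw.span_zero by (simp only:)
    next
      case (step c b v)
      have "summand j (sc c b + v) = pointwise sc c (summand j b) + summand j v"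
        by (auto simp: summand_def pointwise_def)
      moreover have "summand j b \<in> pw.span C"
        using j step by (intro pw.span_base) (auto simp: C_def)
      ultimately show ?case
        using step by (simp only: pw.span_add pw.span_scale)
    qed
    show "tuples n V \<subseteq> pw.span C"
    proof
      fix x assume x: "x \<in> tuples n V"
      have "x = (\<Sum>j\<in>{1..n}. summand j (x j))"
      proof
        show "x i = (\<Sum>j\<in>{1..n}. summand j (x j)) i" for i
          using x by (simp add: sum_fun_apply summand_def tuples_iff)
      qed
      also have "\<dots> \<in> pw.span C"
        using x B by (intro pw.span_sum single) auto
      finally show "x \<in> pw.span C" .
    qed
  qed
  ultimately show ?thesis
    using pw.vector_space_axioms by (auto simp: fin_dim_space_def)
qed

lemma lie_algebra_power: "lie_algebra (lie_power L n)"
proof -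
  have "br (x i) (br (y i) (z i)) + br (y i) (br (z i) (x i)) + br (z i) (br (x i) (y i)) = 0"
    if "x \<in> tuples n V" "y \<in> tuples n V" "z \<in> tuples n V" for x y z and i :: nat
    using lie that by (simp add: lie_algebra_def lie_bracket_def)
  moreover have "bilinear_on (pointwise sc) (tuples n V) (pointwise sc) (brk (lie_power L n))"
    unfolding bilinear_on_def linear_on_def
    by (intro conjI ballI allI ext) (simp_all add: pointwise_apply)
  ultimately have "lie_bracket (pointwise sc) (tuples n V) (brk (lie_power L n))"
    unfolding lie_bracket_def
    by (intro conjI ballI ext) (simp_all add: tuples_iff)
  then show ?thesis
    using fin_dim_power by (simp add: lie_algebra_def)
qed

lemma tuples_dual_iff:
  "\<xi> \<in> tuples n (dual L) \<longleftrightarrow> (\<forall>i. \<xi> i \<in> dual L) \<and> (\<forall>i. i \<notin> {1..n} \<longrightarrow> \<xi> i = 0)"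
  unfolding tuples_def using dual_closed(1) by fastforce

lemma tuples_dual_apply [simp]: "\<xi> \<in> tuples n (dual L) \<Longrightarrow> \<xi> i \<in> dual L"
  by (simp add: tuples_dual_iff)

end

locale lie_tuples = lie_alg L
  for L :: "('k::field_char_0, 'a::ab_group_add) lie" +
  fixes n :: nat
begin

sublocale pow: lie_alg "lie_power L n"
  by unfold_locales (rule lie_algebra_power)

abbreviation hat where "hat \<equiv> dual_tuple L n"
abbreviation dual_tuples where "dual_tuples \<equiv> tuples n (dual L)"

lemma hat_apply: "x \<in> tuples n V \<Longrightarrow> hat \<xi> x = (\<Sum>j\<in>{1..n}. \<xi> j (x j))"
  by (simp add: dual_tuple_def)

lemma hat_in_dual [simp]: "\<xi> \<in> dual_tuples \<Longrightarrow> hat \<xi> \<in> dual (lie_power L n)"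
  using bij_betw_dual_tuple[OF lie] by (metis bij_betwE)

lemma dual_powerE:
  assumes "\<zeta> \<in> dual (lie_power L n)"
  obtains \<xi> where "\<xi> \<in> dual_tuples" "\<zeta> = hat \<xi>"
  using assms bij_betw_dual_tuple[OF lie, of n] unfolding bij_betw_def by blast

lemma hat_summand [simp]:
  assumes "\<xi> \<in> dual_tuples" "j \<in> {1..n}" "x \<in> V"
  shows "hat \<xi> (summand j x) = \<xi> j x"
proof -
  have "hat \<xi> (summand j x) = (\<Sum>i\<in>{1..n}. if i = j then \<xi> j x else 0)"
    using assms unfolding hat_apply[OF summand_in_tuples[OF assms(2,3)]]
    by (intro sum.cong) (auto simp: summand_def)
  then show ?thesis using assms by simp
qed

lemma hat_linear:
  "linear_on (pointwise (pointwise (*))) dual_tuples (pointwise (*)) hat"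
proof -
  have "hat (\<xi> + \<eta>) = hat \<xi> + hat \<eta>" for \<xi> \<eta>
    by (auto simp: dual_tuple_def sum.distrib fun_eq_iff)
  moreover have "hat (pointwise (pointwise (*)) c \<xi>) = pointwise (*) c (hat \<xi>)" for c \<xi>
    by (auto simp: dual_tuple_def sum_distrib_left pointwise_def fun_eq_iff)
  ultimately show ?thesis by (simp add: linear_on_def)
qed

end

locale tensor_power = lie_tensor L r
  for L :: "('k::field_char_0, 'a::ab_group_add) lie" and r +
  fixes n :: nat
begin

sublocale lie_tuples L n ..

lemma tensor_summand_closed:
  assumes "t \<in> tensor_space L" "j \<in> {1..n}"
  shows "tensor_summand L n j t \<in> tensor_space (lie_power L n)"
  unfolding tensor_summand_def tensor_map_def
  by (rule pow.tlift_closed[OF assms(1)]) (use assms in simp)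

lemma tensor_summand_apply:
  assumes t: "t \<in> tensor_space L" and j: "j \<in> {1..n}" and d: "\<xi> \<in> dual_tuples" "\<eta> \<in> dual_tuples"
  shows "tensor_summand L n j t (hat \<xi>) (hat \<eta>) = t (\<xi> j) (\<eta> j)"
proof -
  have "tlift L (\<lambda>x y. tensor (lie_power L n) (summand j x) (summand j y) (hat \<xi>) (hat \<eta>)) t
      = 1 * t (\<xi> j) (\<eta> j)"
    by (rule tlift_product[OF t]) (use d j in \<open>auto simp: tensor_def\<close>)
  then show ?thesis by (simp add: tensor_summand_def tensor_map_def tlift_fun_apply)
qed

lemma wedge_summands_apply:
  assumes "j \<in> {1..n}" "k \<in> {1..n}" and d: "\<xi> \<in> dual_tuples" "\<eta> \<in> dual_tuples"
  shows "tlift L (\<lambda>x y. wedge (lie_power L n) (summand j y) (summand k x)) r (hat \<xi>) (hat \<eta>)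
    = r (\<eta> k) (\<xi> j) - r (\<xi> k) (\<eta> j)"
proof -
  have "tlift L (\<lambda>x y. hat \<xi> (summand j y) * hat \<eta> (summand k x)) r = 1 * r (\<eta> k) (\<xi> j)"
    by (rule tlift_product[OF tensor]) (use assms in auto)
  moreover have "tlift L (\<lambda>x y. hat \<eta> (summand j y) * hat \<xi> (summand k x)) r = 1 * r (\<xi> k) (\<eta> j)"
    by (rule tlift_product[OF tensor]) (use assms in auto)
  ultimately show ?thesis
    using d by (simp add: tlift_fun_apply wedge_apply tlift_diff)
qed

lemma r_power_closed: "r_power L r n \<in> tensor_space (lie_power L n)"
proof -
  have "tlift L (\<lambda>x y. wedge (lie_power L n) (summand j y) (summand k x)) r
      \<in> tensor_space (lie_power L n)" if "j \<in> {1..n}" "k \<in> {1..n}" for j k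
    by (rule pow.tlift_closed[OF tensor]) (use that in \<open>simp add: wedge_def\<close>)
  then show ?thesis
    unfolding r_power_def using tensor
    by (intro pow.tensor_space_add pow.tensor_space_diff pow.tensor_space_sum
        tensor_summand_closed) auto
qed

lemma r_power_apply:
  assumes d: "\<xi> \<in> dual_tuples" "\<eta> \<in> dual_tuples"
  shows "r_power L r n (hat \<xi>) (hat \<eta>) =
    (\<Sum>j\<in>{1..n}. (if odd j then r (\<xi> j) (\<eta> j) else - r (\<eta> j) (\<xi> j))
      + (\<Sum>i\<in>{1..<j}. r (\<xi> j) (\<eta> i) - r (\<eta> j) (\<xi> i)))"
proof -
  have "(\<Sum>j | j \<in> {1..n} \<and> odd j. tensor_summand L n j r) (hat \<xi>) (hat \<eta>)
      = (\<Sum>j | j \<in> {1..n} \<and> odd j. r (\<xi> j) (\<eta> j))"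
    unfolding sum_fun_apply by (intro sum.cong) (use tensor d in \<open>simp_all add: tensor_summand_apply\<close>)
  moreover have "(\<Sum>j | j \<in> {1..n} \<and> even j. tensor_summand L n j (- flip_tensor L r)) (hat \<xi>) (hat \<eta>)
      = (\<Sum>j | j \<in> {1..n} \<and> even j. - r (\<eta> j) (\<xi> j))"
    unfolding sum_fun_apply by (intro sum.cong) (use tensor d in \<open>simp_all add: tensor_summand_apply\<close>)
  moreover have "(\<Sum>j\<in>{1..n}. if odd j then r (\<xi> j) (\<eta> j) else - r (\<eta> j) (\<xi> j))
      = (\<Sum>j | j \<in> {1..n} \<and> odd j. r (\<xi> j) (\<eta> j)) + (\<Sum>j | j \<in> {1..n} \<and> even j. - r (\<eta> j) (\<xi> j))"
    by (subst sum.If_cases) (simp_all add: Int_def)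
  moreover have "(\<Sum>k\<in>{1..n}. \<Sum>j\<in>{1..<k}.
      tlift L (\<lambda>x y. wedge (lie_power L n) (summand j y) (summand k x)) r) (hat \<xi>) (hat \<eta>)
      = (\<Sum>k\<in>{1..n}. \<Sum>j\<in>{1..<k}. r (\<eta> k) (\<xi> j) - r (\<xi> k) (\<eta> j))"
    unfolding sum_fun_apply by (intro sum.cong refl wedge_summands_apply d) auto
  ultimately show ?thesis
    by (simp add: r_power_def sum.distrib sum_subtractf)
qed

sublocale pow: lie_tensor "lie_power L n" "r_power L r n"
  by unfold_locales (rule r_power_closed)

end

lemma double_sum_split:
  fixes f :: "nat \<Rightarrow> nat \<Rightarrow> 'b::comm_monoid_add"
  shows "(\<Sum>j\<in>{1..n}. \<Sum>i\<in>{1..n}. f i j) = (\<Sum>j\<in>{1..n}. f j j + (\<Sum>i\<in>{1..<j}. f i j + f j i))"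
proof (induction n)
  case (Suc n)
  have "{1..<Suc n} = {1..n}" by auto
  then show ?case
    using Suc by (simp add: sum.distrib add_ac)
qed simp

lemma sum_telescope_from_1:
  fixes f :: "nat \<Rightarrow> 'b::ab_group_add"
  shows "a \<le> b \<Longrightarrow> (\<Sum>j\<in>{Suc a..b}. f j - f (j - 1)) = f b - f a"
  by (induction b rule: dec_induct) simp_all

context tensor_power
begin

definition partial_sum :: "(nat \<Rightarrow> 'a \<Rightarrow> 'k) \<Rightarrow> nat \<Rightarrow> 'a \<Rightarrow> 'k" where
  "partial_sum \<xi> j = (\<Sum>i\<in>{1..j}. \<xi> i)"

text \<open>
  The points \<open>U\<^sub>j\<close> of the introduction, from \<open>p\<close> of the total at \<open>j = 0\<close> to \<open>q\<close> of the total at \<open>j = n\<close>.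
\<close>

definition interpolant where "interpolant \<xi> j = p (partial_sum \<xi> n) - s (partial_sum \<xi> j)"

text \<open>
  The end points of the \<open>j\<close>-th step, which is run from \<open>j - 1\<close> to \<open>j\<close> if \<open>j\<close> is odd and backwards if \<open>j\<close>
  is even.
\<close>

definition before :: "nat \<Rightarrow> nat" where "before j = (if odd j then j - 1 else j)"
definition after :: "nat \<Rightarrow> nat" where "after j = (if odd j then j else j - 1)"

lemma interpolant_closed [simp]: "interpolant \<xi> j \<in> V"
  by (simp add: interpolant_def)

lemma partial_sum_dual [simp]: "\<xi> \<in> dual_tuples \<Longrightarrow> partial_sum \<xi> j \<in> dual L"
  by (simp add: partial_sum_def)

lemma partial_sum_diff: "j \<ge> 1 \<Longrightarrow> partial_sum \<xi> j - partial_sum \<xi> (j - 1) = \<xi> j"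
  by (cases j) (simp_all add: partial_sum_def)

lemma r_partial_sum:
  assumes "\<xi> \<in> dual_tuples" "\<eta> \<in> dual L"
  shows "r (partial_sum \<xi> j) \<eta> = (\<Sum>i\<in>{1..j}. r (\<xi> i) \<eta>)"
    and "r \<eta> (partial_sum \<xi> j) = (\<Sum>i\<in>{1..j}. r \<eta> (\<xi> i))"
proof -
  have "r (partial_sum \<xi> j) \<eta> = - partial_sum \<xi> j (q \<eta>)"
    using assms by (simp add: dual_r_minus)
  also have "\<dots> = (\<Sum>i\<in>{1..j}. - \<xi> i (q \<eta>))"
    by (simp add: partial_sum_def sum_fun_apply sum_negf)
  also have "\<dots> = (\<Sum>i\<in>{1..j}. r (\<xi> i) \<eta>)"
    using assms by (simp add: dual_r_minus)
  finally show "r (partial_sum \<xi> j) \<eta> = (\<Sum>i\<in>{1..j}. r (\<xi> i) \<eta>)" .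
  have "r \<eta> (partial_sum \<xi> j) = partial_sum \<xi> j (p \<eta>)"
    using assms by (simp add: dual_r_plus)
  also have "\<dots> = (\<Sum>i\<in>{1..j}. \<xi> i (p \<eta>))"
    by (simp add: partial_sum_def sum_fun_apply)
  also have "\<dots> = (\<Sum>i\<in>{1..j}. r \<eta> (\<xi> i))"
    using assms by (simp add: dual_r_plus)
  finally show "r \<eta> (partial_sum \<xi> j) = (\<Sum>i\<in>{1..j}. r \<eta> (\<xi> i))" .
qed

text \<open>
  In \<open>\<langle>\<eta>\<^sub>j, U\<^sub>k\<rangle>\<close> the sum over all indices comes from \<open>p\<close> of the total; the terms \<open>r(\<xi>\<^sub>i, \<eta>\<^sub>j)\<close> with
  \<open>i \<le> k\<close> are replaced by \<open>- r(\<eta>\<^sub>j, \<xi>\<^sub>i)\<close>. The predicate \<open>c\<close> decides on which side the diagonal term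
  \<open>i = j\<close> lies. It is the parity for one of the two maps and the opposite parity for the other, which
  allows one computation for both.
\<close>

lemma sum_dual_interpolant:
  assumes d: "\<xi> \<in> dual_tuples" "\<eta> \<in> dual_tuples"
  shows "(\<Sum>j\<in>{1..n}. \<eta> j (interpolant \<xi> (if c j then j - 1 else j))) =
    (\<Sum>j\<in>{1..n}. (if c j then r (\<xi> j) (\<eta> j) else - r (\<eta> j) (\<xi> j))
      + (\<Sum>i\<in>{1..<j}. r (\<xi> j) (\<eta> i) - r (\<eta> j) (\<xi> i)))"
proof -
  define f where "f i j = r (\<xi> i) (\<eta> j)" for i j
  define g where "g i j = r (\<eta> j) (\<xi> i)" for i j
  have interpolant: "\<eta> j (interpolant \<xi> k) = (\<Sum>i\<in>{1..n}. f i j) - (\<Sum>i\<in>{1..k}. f i j + g i j)" for j k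
    using d by (simp add: interpolant_def dual_r_plus dual_r_minus r_partial_sum f_def g_def sum.distrib algebra_simps)
  have last: "(\<Sum>i\<in>{1..if c j then j - 1 else j}. f i j + g i j)
      = (\<Sum>i\<in>{1..<j}. f i j + g i j) + (if c j then 0 else f j j + g j j)" if "j \<in> {1..n}" for j
  proof -
    obtain k where "j = Suc k" using \<open>j \<in> {1..n}\<close> by (cases j) auto
    then have "{1..<j} = {1..k}" by auto
    then show ?thesis by (simp add: \<open>j = Suc k\<close>)
  qed
  have "(\<Sum>j\<in>{1..n}. \<eta> j (interpolant \<xi> (if c j then j - 1 else j)))
      = (\<Sum>j\<in>{1..n}. \<Sum>i\<in>{1..n}. f i j)
        - (\<Sum>j\<in>{1..n}. (\<Sum>i\<in>{1..<j}. f i j + g i j) + (if c j then 0 else f j j + g j j))"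
    unfolding interpolant sum_subtractf using last by simp
  also have "\<dots> = (\<Sum>j\<in>{1..n}. (if c j then f j j else - g j j) + (\<Sum>i\<in>{1..<j}. f j i - g i j))"
    unfolding double_sum_split sum_subtractf[symmetric]
    by (intro sum.cong) (simp_all add: sum.distrib sum_subtractf)
  finally show ?thesis by (simp only: f_def g_def)
qed

lemma interpolant_tuple_closed: "(\<lambda>j. if j \<in> {1..n} then interpolant \<xi> (k j) else 0) \<in> tuples n V"
  by (auto simp: tuples_iff)

lemma power_maps_closed [simp]: "pow.p \<zeta> \<in> tuples n V" "pow.q \<zeta> \<in> tuples n V"
  using pow.r_maps_closed[of \<zeta>] by simp_all

lemma r_plus_power:
  assumes \<xi>: "\<xi> \<in> dual_tuples"
  shows "pow.p (hat \<xi>) = (\<lambda>j. if j \<in> {1..n} then interpolant \<xi> (before j) else 0)"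
proof (rule pow.dual_separates)
  fix \<zeta> assume "\<zeta> \<in> dual (lie_power L n)"
  then obtain \<eta> where \<eta>: "\<eta> \<in> dual_tuples" "\<zeta> = hat \<eta>" by (rule dual_powerE)
  have "hat \<eta> (pow.p (hat \<xi>)) = r_power L r n (hat \<xi>) (hat \<eta>)"
    using \<xi> \<eta> by (intro pow.dual_r_plus) simp_all
  also have "\<dots> = (\<Sum>j\<in>{1..n}. \<eta> j (interpolant \<xi> (before j)))"
    unfolding before_def sum_dual_interpolant[OF \<xi> \<eta>(1)] by (rule r_power_apply[OF \<xi> \<eta>(1)])
  finally show "\<zeta> (pow.p (hat \<xi>)) = \<zeta> (\<lambda>j. if j \<in> {1..n} then interpolant \<xi> (before j) else 0)"
    unfolding \<eta>(2) hat_apply[OF interpolant_tuple_closed] by simp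
qed (use interpolant_tuple_closed in simp_all)

lemma r_minus_power:
  assumes \<xi>: "\<xi> \<in> dual_tuples"
  shows "pow.q (hat \<xi>) = (\<lambda>j. if j \<in> {1..n} then interpolant \<xi> (after j) else 0)"
proof (rule pow.dual_separates)
  fix \<zeta> assume "\<zeta> \<in> dual (lie_power L n)"
  then obtain \<eta> where \<eta>: "\<eta> \<in> dual_tuples" "\<zeta> = hat \<eta>" by (rule dual_powerE)
  have "hat \<eta> (pow.q (hat \<xi>)) = - r_power L r n (hat \<eta>) (hat \<xi>)"
    using \<xi> \<eta> by (intro pow.dual_r_minus) simp_all
  also have "\<dots> = (\<Sum>j\<in>{1..n}. (if even j then r (\<xi> j) (\<eta> j) else - r (\<eta> j) (\<xi> j))
      + (\<Sum>i\<in>{1..<j}. r (\<xi> j) (\<eta> i) - r (\<eta> j) (\<xi> i)))"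
    unfolding r_power_apply[OF \<eta>(1) \<xi>] sum_negf[symmetric]
    by (intro sum.cong) (simp_all add: sum_subtractf)
  also have "\<dots> = (\<Sum>j\<in>{1..n}. \<eta> j (interpolant \<xi> (after j)))"
    unfolding sum_dual_interpolant[OF \<xi> \<eta>(1), symmetric] by (intro sum.cong) (simp_all add: after_def)
  finally show "\<zeta> (pow.q (hat \<xi>)) = \<zeta> (\<lambda>j. if j \<in> {1..n} then interpolant \<xi> (after j) else 0)"
    unfolding \<eta>(2) hat_apply[OF interpolant_tuple_closed] by simp
qed (use interpolant_tuple_closed in simp_all)

lemma hat_brk:
  assumes "\<xi> \<in> dual_tuples" "x \<in> tuples n V" "y \<in> tuples n V"
  shows "hat \<xi> (pow.br x y) = (\<Sum>j\<in>{1..n}. \<xi> j (br (x j) (y j)))"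
  using assms pow.brk_closed[of x y] by (subst hat_apply) simp_all

lemma interpolant_step: "1 \<le> j \<Longrightarrow> interpolant \<xi> (j - 1) - interpolant \<xi> j = s (\<xi> j)"
proof -
  assume "1 \<le> j"
  have "interpolant \<xi> (j - 1) - interpolant \<xi> j = s (partial_sum \<xi> j - partial_sum \<xi> (j - 1))"
    by (simp add: interpolant_def algebra_simps)
  then show ?thesis by (simp only: partial_sum_diff[OF \<open>1 \<le> j\<close>])
qed

end

locale quasitriangular_power = quasitriangular_lie L r
  for L :: "('k::field_char_0, 'a::ab_group_add) lie" and r +
  fixes n :: nat
begin

sublocale tensor_power L r n ..

text \<open>
  The end points of the \<open>j\<close>-th step differ by \<open>s(\<xi>\<^sub>j)\<close>, up to a sign that alternates with \<open>j\<close>; so the symmetric part of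
  \<open>r\<^sup>(\<^sup>n\<^sup>)\<close> is the sum of those of \<open>r\<close> with alternating signs, and the cross terms are purely skew.
\<close>

lemma power_invariance:
  assumes x: "x \<in> tuples n V" and d: "\<xi> \<in> dual_tuples" "\<eta> \<in> dual_tuples"
  shows "hat \<eta> (pow.br x (pow.s (hat \<xi>))) + hat \<xi> (pow.br x (pow.s (hat \<eta>))) = 0"
proof -
  have s: "pow.s (hat \<zeta>) j = (if odd j then s (\<zeta> j) else - s (\<zeta> j))"
    if "\<zeta> \<in> dual_tuples" "j \<in> {1..n}" for \<zeta> j
    using that interpolant_step[of j \<zeta>] by (auto simp: r_plus_power r_minus_power before_def after_def algebra_simps)
  have "\<eta> j (br (x j) (pow.s (hat \<xi>) j)) + \<xi> j (br (x j) (pow.s (hat \<eta>) j)) = 0"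
    if j: "j \<in> {1..n}" for j
    using invariance[of "\<xi> j" "\<eta> j" "x j"] x d unfolding s[OF d(1) j] s[OF d(2) j]
    by (auto simp: algebra_simps)
  moreover have "pow.s (hat \<zeta>) \<in> tuples n V" for \<zeta>
    using pow.closed(3)[OF pow.r_maps_closed] by simp
  ultimately show ?thesis
    using x d by (simp add: hat_brk sum.distrib[symmetric]
        del: minus_apply pow.brk_diff)
qed

lemma power_yang_baxter:
  assumes d: "\<xi> \<in> dual_tuples" "\<eta> \<in> dual_tuples" "\<theta> \<in> dual_tuples"
  shows "hat \<xi> (pow.br (pow.q (hat \<eta>)) (pow.q (hat \<theta>)))
    - hat \<eta> (pow.br (pow.p (hat \<xi>)) (pow.q (hat \<theta>)))
    + hat \<theta> (pow.br (pow.p (hat \<xi>)) (pow.p (hat \<eta>))) = 0"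
proof -
  let ?x = "partial_sum \<xi>" and ?y = "partial_sum \<eta>" and ?z = "partial_sum \<theta>"
  define F where "F j = yang_baxter_potential (p (?x n)) (p (?y n)) (p (?z n)) (?x j) (?y j) (?z j)" for j
  have summand: "\<xi> j (br (interpolant \<eta> (after j)) (interpolant \<theta> (after j)))
      - \<eta> j (br (interpolant \<xi> (before j)) (interpolant \<theta> (after j)))
      + \<theta> j (br (interpolant \<xi> (before j)) (interpolant \<eta> (before j))) = F j - F (j - 1)"
    if j: "j \<in> {1..n}" for j
  proof (cases "odd j")
    case True
    have "(?x j - ?x (j - 1)) (br (interpolant \<eta> j) (interpolant \<theta> j))
        - (?y j - ?y (j - 1)) (br (interpolant \<xi> (j - 1)) (interpolant \<theta> j))
        + (?z j - ?z (j - 1)) (br (interpolant \<xi> (j - 1)) (interpolant \<eta> (j - 1))) = F j - F (j - 1)"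
      unfolding interpolant_def F_def using d by (intro yang_baxter_potential_difference) simp_all
    then show ?thesis
      using True j by (simp only: partial_sum_diff before_def after_def if_True
          atLeastAtMost_iff not_False_eq_True)
  next
    case False
    have "(?x (j - 1) - ?x j) (br (interpolant \<eta> (j - 1)) (interpolant \<theta> (j - 1)))
        - (?y (j - 1) - ?y j) (br (interpolant \<xi> j) (interpolant \<theta> (j - 1)))
        + (?z (j - 1) - ?z j) (br (interpolant \<xi> j) (interpolant \<eta> j)) = F (j - 1) - F j"
      unfolding interpolant_def F_def using d by (intro yang_baxter_potential_difference) simp_all
    moreover have neg: "partial_sum \<zeta> (j - 1) - partial_sum \<zeta> j = - \<zeta> j" for \<zeta>
      using partial_sum_diff[of j \<zeta>] j by (metis minus_diff_eq atLeastAtMost_iff)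
    ultimately have "F j - F (j - 1) = - ((- \<xi> j) (br (interpolant \<eta> (j - 1)) (interpolant \<theta> (j - 1)))
        - (- \<eta> j) (br (interpolant \<xi> j) (interpolant \<theta> (j - 1)))
        + (- \<theta> j) (br (interpolant \<xi> j) (interpolant \<eta> j)))"
      unfolding neg by (simp only: minus_diff_eq)
    then show ?thesis
      using False by (simp add: before_def after_def)
  qed
  \<comment> \<open>At the last step, \<open>p\<close> of the total minus \<open>s\<close> of the total is \<open>q\<close> of the total.\<close>
  have "F n = 0"
    using yang_baxter[of "?x n" "?y n" "?z n"] d by (simp add: F_def yang_baxter_potential_def)
  moreover have "F 0 = 0"
    using d by (simp add: F_def yang_baxter_potential_def partial_sum_def)
  moreover have "(\<Sum>j\<in>{1..n}. F j - F (j - 1)) = F n - F 0"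
    using sum_telescope_from_1[of 0 n F] by simp
  ultimately have "(\<Sum>j\<in>{1..n}. \<xi> j (br (interpolant \<eta> (after j)) (interpolant \<theta> (after j)))
      - \<eta> j (br (interpolant \<xi> (before j)) (interpolant \<theta> (after j)))
      + \<theta> j (br (interpolant \<xi> (before j)) (interpolant \<eta> (before j)))) = 0"
    using summand by simp
  then show ?thesis
    using d interpolant_tuple_closed
    by (simp add: hat_brk r_plus_power r_minus_power sum.distrib sum_subtractf)
qed

lemma quasitriangular_power: "quasitriangular (lie_power L n) (r_power L r n)"
  unfolding pow.quasitriangular_iff
  using power_invariance power_yang_baxter by (auto elim!: dual_powerE)

sublocale pow: quasitriangular_lie "lie_power L n" "r_power L r n"
  by unfold_locales (rule quasitriangular_power)

end

section \<open>The bracket on the dual of a power\<close>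

context quasitriangular_power
begin

text \<open>
  The bracket potential along the two sequences of partial sums, with the totals of the tuples in the
  constant slots.
\<close>

definition potential_along :: "(nat \<Rightarrow> 'a \<Rightarrow> 'k) \<Rightarrow> (nat \<Rightarrow> 'a \<Rightarrow> 'k) \<Rightarrow> 'a \<Rightarrow> nat \<Rightarrow> 'k" where
  "potential_along \<xi> \<eta> x j =
    bracket_potential (p (partial_sum \<xi> n)) (p (partial_sum \<eta> n))
      (partial_sum \<xi> j) (partial_sum \<eta> j) x"

lemma power_bracket_apply:
  assumes d: "\<xi> \<in> dual_tuples" "\<eta> \<in> dual_tuples" and x: "x \<in> tuples n V"
  shows "pow.bracket (hat \<xi>) (hat \<eta>) x
    = (\<Sum>j\<in>{1..n}. potential_along \<xi> \<eta> (x j) j - potential_along \<xi> \<eta> (x j) (j - 1))"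
proof -
  have summand: "\<eta> j (br (x j) (interpolant \<xi> (before j))) - \<xi> j (br (x j) (interpolant \<eta> (after j)))
      = potential_along \<xi> \<eta> (x j) j - potential_along \<xi> \<eta> (x j) (j - 1)" if j: "j \<in> {1..n}" for j
  proof (cases "odd j")
    case True
    have "(partial_sum \<eta> j - partial_sum \<eta> (j - 1)) (br (x j) (interpolant \<xi> (j - 1)))
        - (partial_sum \<xi> j - partial_sum \<xi> (j - 1)) (br (x j) (interpolant \<eta> j))
        = potential_along \<xi> \<eta> (x j) j - potential_along \<xi> \<eta> (x j) (j - 1)"
      unfolding interpolant_def potential_along_def using d x by (intro bracket_potential_difference) simp_all
    then show ?thesis
      using True j by (simp only: partial_sum_diff before_def after_def if_True
          atLeastAtMost_iff not_False_eq_True)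
  next
    case False
    have "(partial_sum \<eta> (j - 1) - partial_sum \<eta> j) (br (x j) (interpolant \<xi> j))
        - (partial_sum \<xi> (j - 1) - partial_sum \<xi> j) (br (x j) (interpolant \<eta> (j - 1)))
        = potential_along \<xi> \<eta> (x j) (j - 1) - potential_along \<xi> \<eta> (x j) j"
      unfolding interpolant_def potential_along_def using d x by (intro bracket_potential_difference) simp_all
    moreover have neg: "partial_sum \<zeta> (j - 1) - partial_sum \<zeta> j = - \<zeta> j" for \<zeta>
      using partial_sum_diff[of j \<zeta>] j by (metis minus_diff_eq atLeastAtMost_iff)
    ultimately have "potential_along \<xi> \<eta> (x j) j - potential_along \<xi> \<eta> (x j) (j - 1)
        = - ((- \<eta> j) (br (x j) (interpolant \<xi> j)) - (- \<xi> j) (br (x j) (interpolant \<eta> (j - 1))))"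
      unfolding neg by (simp only: minus_diff_eq)
    then show ?thesis
      using False by (simp add: before_def after_def)
  qed
  have "pow.bracket (hat \<xi>) (hat \<eta>) x
      = (\<Sum>j\<in>{1..n}. \<eta> j (br (x j) (interpolant \<xi> (before j))) - \<xi> j (br (x j) (interpolant \<eta> (after j))))"
    using d x interpolant_tuple_closed
    by (simp add: pow.bracket_apply hat_brk r_plus_power r_minus_power sum_subtractf)
  then show ?thesis using summand by simp
qed

lemma partial_sum_split:
  assumes "j \<in> {1..n}"
  shows "partial_sum \<xi> n = (\<Sum>i\<in>{1..<j}. \<xi> i) + \<xi> j + (\<Sum>i\<in>{j<..n}. \<xi> i)"
    and "partial_sum \<xi> (j - 1) = (\<Sum>i\<in>{1..<j}. \<xi> i)"
    and "partial_sum \<xi> j = (\<Sum>i\<in>{1..<j}. \<xi> i) + \<xi> j"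
proof -
  have *: "{1..<j} = {1..j - 1}" using assms by auto
  show 1: "partial_sum \<xi> (j - 1) = (\<Sum>i\<in>{1..<j}. \<xi> i)" by (simp only: partial_sum_def *)
  show 2: "partial_sum \<xi> j = (\<Sum>i\<in>{1..<j}. \<xi> i) + \<xi> j"
    using partial_sum_diff[of j \<xi>] assms 1 by (metis diff_eq_eq add.commute atLeastAtMost_iff)
  have "{1..n} = {1..j} \<union> {j<..n}" using assms by auto
  then have "partial_sum \<xi> n = partial_sum \<xi> j + (\<Sum>i\<in>{j<..n}. \<xi> i)"
    unfolding partial_sum_def by (simp only:) (rule sum.union_disjoint, auto)
  then show "partial_sum \<xi> n = (\<Sum>i\<in>{1..<j}. \<xi> i) + \<xi> j + (\<Sum>i\<in>{j<..n}. \<xi> i)"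
    by (simp only: 2)
qed

text \<open>
  In the bracket formula of the theorem every step is taken forwards, independently of the parity of its
  index. With \<open>U\<^sub>j\<^sub>-\<^sub>1 = p(\<xi>\<^sub>j) + q(\<xi>\<^sub>1 + \<dots> + \<xi>\<^sub>j\<^sub>-\<^sub>1) + p(\<xi>\<^sub>j\<^sub>+\<^sub>1 + \<dots> + \<xi>\<^sub>n)\<close>, and with \<open>q(\<xi>\<^sub>j)\<close> in the place of
  \<open>p(\<xi>\<^sub>j)\<close> for \<open>U\<^sub>j\<close>, the terms with \<open>p(\<xi>\<^sub>j)\<close> and \<open>q(\<eta>\<^sub>j)\<close> make up \<open>[\<xi>\<^sub>j, \<eta>\<^sub>j]\<close> and the others are the
  coadjoint terms.
\<close>

lemma power_dual_bracket_apply: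
  assumes d: "\<xi> \<in> dual_tuples" "\<eta> \<in> dual_tuples" and x: "x \<in> V" and j: "j \<in> {1..n}"
  shows "power_dual_bracket L r n \<xi> \<eta> j x
    = potential_along \<xi> \<eta> x j - potential_along \<xi> \<eta> x (j - 1)"
proof -
  have "potential_along \<xi> \<eta> x j - potential_along \<xi> \<eta> x (j - 1)
      = (partial_sum \<eta> j - partial_sum \<eta> (j - 1)) (br x (interpolant \<xi> (j - 1)))
      - (partial_sum \<xi> j - partial_sum \<xi> (j - 1)) (br x (interpolant \<eta> j))"
    unfolding interpolant_def potential_along_def using d x by (intro bracket_potential_difference[symmetric]) simp_all
  also have "\<dots> = \<eta> j (br x (interpolant \<xi> (j - 1))) - \<xi> j (br x (interpolant \<eta> j))"
    using j by (simp only: partial_sum_diff atLeastAtMost_iff)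
  also have "interpolant \<xi> (j - 1) = p (\<xi> j) + (q (\<Sum>i\<in>{1..<j}. \<xi> i) + p (\<Sum>i\<in>{j<..n}. \<xi> i))"
    unfolding interpolant_def partial_sum_split(1,2)[OF j] by (simp add: algebra_simps)
  also have "interpolant \<eta> j = q (\<eta> j) + (q (\<Sum>i\<in>{1..<j}. \<eta> i) + p (\<Sum>i\<in>{j<..n}. \<eta> i))"
    unfolding interpolant_def partial_sum_split(1,3)[OF j] by (simp add: algebra_simps)
  finally show ?thesis
    using d x j by (simp add: power_dual_bracket_def bracket_apply)
qed

lemma power_dual_bracket_closed:
  assumes "\<xi> \<in> dual_tuples" "\<eta> \<in> dual_tuples"
  shows "power_dual_bracket L r n \<xi> \<eta> \<in> dual_tuples"
  using assms by (simp add: tuples_dual_iff[of _ n] power_dual_bracket_def)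

lemma dual_bracket_power:
  assumes d: "\<xi> \<in> dual_tuples" "\<eta> \<in> dual_tuples"
  shows "pow.bracket (hat \<xi>) (hat \<eta>) = hat (power_dual_bracket L r n \<xi> \<eta>)"
proof (rule pow.dual_eqI)
  fix x assume "x \<in> lie_set (lie_power L n)"
  then have x: "x \<in> tuples n V" by simp
  show "pow.bracket (hat \<xi>) (hat \<eta>) x = hat (power_dual_bracket L r n \<xi> \<eta>) x"
    unfolding power_bracket_apply[OF d x] hat_apply[OF x]
    using x d by (intro sum.cong) (simp_all add: power_dual_bracket_apply)
qed (use d power_dual_bracket_closed in simp_all)

end

lemma lie_bracket_transport:
  assumes lie: "lie_bracket s' W' b'"
    and f: "inj_on f W" "f ` W \<subseteq> W'" "linear_on s W s' f"
    and W: "0 \<in> W" "\<And>x y. x \<in> W \<Longrightarrow> y \<in> W \<Longrightarrow> x + y \<in> W" "\<And>c x. x \<in> W \<Longrightarrow> s c x \<in> W"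
    and b: "\<And>x y. x \<in> W \<Longrightarrow> y \<in> W \<Longrightarrow> b x y \<in> W"
      "\<And>x y. x \<in> W \<Longrightarrow> y \<in> W \<Longrightarrow> f (b x y) = b' (f x) (f y)"
  shows "lie_bracket s W b"
proof -
  have add: "f (x + y) = f x + f y" if "x \<in> W" "y \<in> W" for x y
    using f(3) that by (simp add: linear_on_def)
  have scale: "f (s c x) = s' c (f x)" and mem: "f x \<in> W'" if "x \<in> W" for x c
    using f(2,3) that by (auto simp: linear_on_def)
  have f0: "f 0 = 0" using add[OF W(1) W(1)] by simp
  note inj = inj_onD[OF f(1)]
  have b': "b' (x + y) z = b' x z + b' y z" "b' z (x + y) = b' z x + b' z y"
    "b' x (b' y z) + b' y (b' z x) + b' z (b' x y) = 0"
    if "x \<in> W'" "y \<in> W'" "z \<in> W'" for x y z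
    using lie that by (simp_all add: lie_bracket_def bilinear_on_def linear_on_def)
  have b'_scale: "b' (s' c x) y = s' c (b' x y)" "b' x (s' c y) = s' c (b' x y)"
    if "x \<in> W'" "y \<in> W'" for x y c
    using lie that by (simp_all add: lie_bracket_def bilinear_on_def linear_on_def)
  have b'_self: "b' x x = 0" if "x \<in> W'" for x
    using lie that by (simp add: lie_bracket_def)
  show ?thesis
    unfolding lie_bracket_def bilinear_on_def linear_on_def
  proof (intro conjI ballI allI)
    fix x y z c assume x: "x \<in> W" and y: "y \<in> W" and z: "z \<in> W"
    note m = mem[OF x] mem[OF y] mem[OF z]
    show "b x y \<in> W" using x y by (rule b)
    show "b x (y + z) = b x y + b x z"
      by (rule inj) (simp_all add: b W add x y z b' m)
    show "b (x + y) z = b x z + b y z"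
      by (rule inj) (simp_all add: b W add x y z b' m)
    show "b x (s c y) = s c (b x y)"
      by (rule inj) (simp_all add: b W scale x y b'_scale m)
    show "b (s c x) y = s c (b x y)"
      by (rule inj) (simp_all add: b W scale x y b'_scale m)
    show "b x x = 0"
      by (rule inj) (simp_all add: b W f0 x b'_self m)
    show "b x (b y z) + b y (b z x) + b z (b x y) = 0"
      by (rule inj) (simp_all add: b W f0 add x y z b' m)
  qed
qed

context quasitriangular_power
begin

lemma lie_bracket_power_dual:
  "lie_bracket (pointwise (pointwise (*))) dual_tuples (power_dual_bracket L r n)"
proof (rule lie_bracket_transport[OF pow.lie_bracket_dual])
  show "inj_on hat dual_tuples"
    using bij_betw_dual_tuple[OF lie] by (rule bij_betw_imp_inj_on)
  show "hat ` dual_tuples \<subseteq> dual (lie_power L n)"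
    by auto
  show "linear_on (pointwise (pointwise (*))) dual_tuples (pointwise (*)) hat"
    by (rule hat_linear)
  show "0 \<in> dual_tuples"
    by (simp add: tuples_dual_iff)
  show "\<xi> + \<eta> \<in> dual_tuples" if "\<xi> \<in> dual_tuples" "\<eta> \<in> dual_tuples" for \<xi> \<eta>
    using that by (simp add: tuples_dual_iff)
  show "pointwise (pointwise (*)) c \<xi> \<in> dual_tuples" if "\<xi> \<in> dual_tuples" for c \<xi>
  proof -
    have "pointwise (*) c (0 :: 'a \<Rightarrow> 'k) = 0" by (simp add: pointwise_def fun_eq_iff)
    then show ?thesis using that by (simp add: tuples_dual_iff pointwise_apply[of "pointwise (*)"])
  qed
qed (simp_all add: power_dual_bracket_closed dual_bracket_power)

end


section \<open>Repeating an entry\<close>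

definition pullback ::
  "('k::field, 'a::ab_group_add) lie \<Rightarrow> ('a \<Rightarrow> 'b) \<Rightarrow> ('b \<Rightarrow> 'k) \<Rightarrow> 'a \<Rightarrow> 'k" where
  "pullback L \<phi> \<xi> x = (if x \<in> lie_set L then \<xi> (\<phi> x) else 0)"

lemma (in lie_alg) pullback_dual:
  assumes \<phi>: "\<phi> ` V \<subseteq> lie_set M" "linear_on sc V (scl M) \<phi>" and \<xi>: "\<xi> \<in> dual M"
  shows "pullback L \<phi> \<xi> \<in> dual L"
proof (rule dualI)
  have "linear_on (scl M) (lie_set M) (*) \<xi>" using \<xi> by (simp add: dual_def)
  moreover have "\<phi> x \<in> lie_set M" if "x \<in> V" for x using \<phi> that by auto
  ultimately show "pullback L \<phi> \<xi> (x + y) = pullback L \<phi> \<xi> x + pullback L \<phi> \<xi> y"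
      "pullback L \<phi> \<xi> (sc c x) = c * pullback L \<phi> \<xi> x" if "x \<in> V" "y \<in> V" for x y c
    using \<phi>(2) that by (auto simp: linear_on_def pullback_def)
qed (simp add: pullback_def)

text \<open>
  A map of Lie bialgebras is recognised on functionals: \<open>(\<phi> \<otimes> \<phi>)(\<delta> x)\<close> at \<open>(\<xi>, \<eta>)\<close> is \<open>\<delta> x\<close> at the
  pullbacks of \<open>\<xi>\<close> and \<open>\<eta>\<close>.
\<close>

lemma (in lie_alg) lie_bialgebra_homI:
  assumes M: "lie_alg M"
    and bialg: "lie_bialgebra L \<delta>" "lie_bialgebra M \<delta>'" and \<phi>: "lie_hom L M \<phi>"
    and \<delta>: "\<And>x. x \<in> V \<Longrightarrow> \<delta> x \<in> tensor_space L"
    and \<delta>': "\<And>x. x \<in> lie_set M \<Longrightarrow> \<delta>' x \<in> tensor_space M"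
    and eq: "\<And>x \<xi> \<eta>. x \<in> V \<Longrightarrow> \<xi> \<in> dual M \<Longrightarrow> \<eta> \<in> dual M \<Longrightarrow>
      \<delta> x (pullback L \<phi> \<xi>) (pullback L \<phi> \<eta>) = \<delta>' (\<phi> x) \<xi> \<eta>"
  shows "lie_bialgebra_hom L \<delta> M \<delta>' \<phi>"
proof -
  interpret M: lie_alg M by (rule M)
  have \<phi>': "\<phi> ` V \<subseteq> lie_set M" "linear_on sc V (scl M) \<phi>"
    using \<phi> by (simp_all add: lie_hom_def)
  have "tensor_map L M \<phi> (\<delta> x) = \<delta>' (\<phi> x)" if x: "x \<in> V" for x
  proof (rule tensor_eqI)
    show "tensor_map L M \<phi> (\<delta> x) \<in> tensor_space M"
      unfolding tensor_map_def using \<phi>'(1)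
      by (intro M.tlift_closed[OF \<delta>[OF x]]) (auto simp: image_subset_iff)
    show "\<delta>' (\<phi> x) \<in> tensor_space M" using \<delta>' \<phi>' x by auto
    fix \<xi> \<eta> assume d: "\<xi> \<in> dual M" "\<eta> \<in> dual M"
    have "tlift L (\<lambda>u v. tensor M (\<phi> u) (\<phi> v) \<xi> \<eta>) (\<delta> x)
        = 1 * \<delta> x (pullback L \<phi> \<xi>) (pullback L \<phi> \<eta>)"
      using d pullback_dual[OF \<phi>'] by (intro tlift_product[OF \<delta>[OF x]])
        (auto simp: tensor_def pullback_def)
    then show "tensor_map L M \<phi> (\<delta> x) \<xi> \<eta> = \<delta>' (\<phi> x) \<xi> \<eta>"
      using eq[OF x d] by (simp add: tensor_map_def tlift_fun_apply)
  qed
  then show ?thesis using bialg \<phi> by (simp add: lie_bialgebra_hom_def)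
qed

text \<open>
  The last position at which the \<open>i\<close>-th entry of an \<open>m\<close>-tuple occurs after the repetition. At \<open>0\<close> the value is
  \<open>0\<close> (as \<open>k \<ge> 1\<close>), so the \<open>i\<close>-th entry fills the positions after \<open>block_end n m k (i - 1)\<close> up to
  \<open>block_end n m k i\<close>.
\<close>

definition block_end :: "nat \<Rightarrow> nat \<Rightarrow> nat \<Rightarrow> nat \<Rightarrow> nat" where
  "block_end n m k i = (if i < k then i else i + (n - m))"

lemma sum_repeat_entry:
  fixes G :: "'a::zero \<Rightarrow> nat \<Rightarrow> 'b::ab_group_add"
  assumes k: "1 \<le> k" "k \<le> m" "m \<le> n"
  shows "(\<Sum>j\<in>{1..n}. G (repeat_entry n m k x j) j - G (repeat_entry n m k x j) (j - 1))
    = (\<Sum>i\<in>{1..m}. G (x i) (block_end n m k i) - G (x i) (block_end n m k (i - 1)))"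
proof -
  define e where "e = n - m"
  have n: "n = m + e" using k by (simp add: e_def)
  let ?y = "repeat_entry n m k x"
  \<comment> \<open>With \<open>a = k + e\<close>, \<open>b = n\<close> and with \<open>a = k\<close>, \<open>b = m\<close> this separates the entries before the
    \<open>k\<close>-th one, the block of the \<open>k\<close>-th entry, and the entries after it.\<close>
  have three: "sum f {1..b} = sum f {1..<k} + (sum f {Suc (k - 1)..a} + sum f {Suc a..b})"
    if "k - 1 \<le> a" "a \<le> b" for f :: "nat \<Rightarrow> 'b" and a b
  proof -
    have "{1..b} = {1..<k} \<union> {k..b}" "{k..b} = {Suc (k - 1)..a} \<union> {Suc a..b}"
      using k that by auto
    then show ?thesis
      using sum.union_disjoint[of "{1..<k}" "{k..b}" f]
        sum.union_disjoint[of "{Suc (k - 1)..a}" "{Suc a..b}" f] by fastforce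
  qed
  have "(\<Sum>j\<in>{1..<k}. G (?y j) j - G (?y j) (j - 1))
      = (\<Sum>i\<in>{1..<k}. G (x i) (block_end n m k i) - G (x i) (block_end n m k (i - 1)))"
    using k by (intro sum.cong) (auto simp: repeat_entry_def block_end_def)
  moreover have "(\<Sum>j\<in>{Suc (k - 1)..k + e}. G (?y j) j - G (?y j) (j - 1))
      = (\<Sum>i\<in>{Suc (k - 1)..k}. G (x i) (block_end n m k i) - G (x i) (block_end n m k (i - 1)))"
  proof -
    have "(\<Sum>j\<in>{Suc (k - 1)..k + e}. G (?y j) j - G (?y j) (j - 1))
        = (\<Sum>j\<in>{Suc (k - 1)..k + e}. G (x k) j - G (x k) (j - 1))"
      using k by (intro sum.cong) (auto simp: repeat_entry_def n)
    also have "\<dots> = G (x k) (k + e) - G (x k) (k - 1)"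
      by (rule sum_telescope_from_1) simp
    finally show ?thesis using k by (simp add: block_end_def n)
  qed
  moreover have "(\<Sum>j\<in>{Suc (k + e)..n}. G (?y j) j - G (?y j) (j - 1))
      = (\<Sum>i\<in>{Suc k..m}. G (x i) (block_end n m k i) - G (x i) (block_end n m k (i - 1)))"
    unfolding n add_Suc[symmetric] sum.shift_bounds_cl_nat_ivl
    using k by (intro sum.cong) (auto simp: repeat_entry_def block_end_def n)
  ultimately show ?thesis
    using three[of "k + e" n] three[of k m] k by (simp add: n)
qed

lemma (in lie_alg) lie_hom_repeat_entry:
  assumes k: "1 \<le> k" "k \<le> m" "m \<le> n"
  shows "lie_hom (lie_power L m) (lie_power L n) (repeat_entry n m k)"
proof -
  have "repeat_entry n m k ` tuples m V \<subseteq> tuples n V"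
    using k by (auto simp: tuples_iff repeat_entry_def)
  moreover have "linear_on (pointwise sc) (tuples m V) (pointwise sc) (repeat_entry n m k)"
    by (auto simp: linear_on_def repeat_entry_def pointwise_apply fun_eq_iff)
  moreover have "repeat_entry n m k (brk (lie_power L m) x y)
      = brk (lie_power L n) (repeat_entry n m k x) (repeat_entry n m k y)"
    if "x \<in> tuples m V" "y \<in> tuples m V" for x y
  proof
    show "repeat_entry n m k (brk (lie_power L m) x y) i
        = brk (lie_power L n) (repeat_entry n m k x) (repeat_entry n m k y) i" for i
      using k by (auto simp: repeat_entry_def)
  qed
  ultimately show ?thesis by (simp add: lie_hom_def)
qed

text \<open>
  With \<open>G\<close> the evaluation of partial sums, \<open>sum_repeat_entry\<close> computes the pullback of a tuple of
  functionals, whose partial sums are those of the original tuple at the ends of the blocks. With \<open>G\<close>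
  the bracket potential, it then compares the cobrackets.
\<close>

lemma (in quasitriangular_lie) lie_bialgebra_hom_repeat_entry:
  assumes k: "1 \<le> k" "k \<le> m" "m \<le> n"
  shows "lie_bialgebra_hom
    (lie_power L m) (cobracket (lie_power L m) (r_power L r m))
    (lie_power L n) (cobracket (lie_power L n) (r_power L r n)) (repeat_entry n m k)"
proof -
  interpret m: quasitriangular_power L r m by unfold_locales
  interpret n: quasitriangular_power L r n by unfold_locales
  let ?\<phi> = "repeat_entry n m k" and ?e = "block_end n m k"
  have hom: "lie_hom (lie_power L m) (lie_power L n) ?\<phi>"
    by (rule lie_hom_repeat_entry[OF k])
  \<comment> \<open>The sum of the functionals over the block of the \<open>i\<close>-th entry.\<close>
  define c where "c \<xi> i = (if i \<in> {1..m} then n.partial_sum \<xi> (?e i) - n.partial_sum \<xi> (?e (i - 1)) else 0)" for \<xi> i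
  have c_dual: "c \<xi> \<in> tuples m (dual L)" if "\<xi> \<in> tuples n (dual L)" for \<xi>
    using that by (simp add: tuples_dual_iff[of _ m] c_def)
  have c_partial_sum: "m.partial_sum (c \<xi>) j = n.partial_sum \<xi> (?e j)" if "j \<le> m" for \<xi> j
    using that
  proof (induction j)
    case 0
    then show ?case using k by (simp add: m.partial_sum_def n.partial_sum_def block_end_def)
  next
    case (Suc j)
    then have "m.partial_sum (c \<xi>) (Suc j) = n.partial_sum \<xi> (?e j) + c \<xi> (Suc j)"
      by (simp add: m.partial_sum_def)
    then show ?case using Suc.prems by (simp add: c_def[of \<xi> "Suc j"])
  qed
  have pullback: "pullback (lie_power L m) ?\<phi> (n.hat \<xi>) = m.hat (c \<xi>)"
    if \<xi>: "\<xi> \<in> tuples n (dual L)" for \<xi>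
  proof
    fix x
    show "pullback (lie_power L m) ?\<phi> (n.hat \<xi>) x = m.hat (c \<xi>) x"
    proof (cases "x \<in> tuples m V")
      case True
      then have "?\<phi> x \<in> tuples n V" using hom by (auto simp: lie_hom_def)
      then have "n.hat \<xi> (?\<phi> x) = (\<Sum>j\<in>{1..n}. \<xi> j (?\<phi> x j))" by (rule n.hat_apply)
      also have "\<dots> = (\<Sum>j\<in>{1..n}. n.partial_sum \<xi> j (?\<phi> x j) - n.partial_sum \<xi> (j - 1) (?\<phi> x j))"
        using n.partial_sum_diff[of _ \<xi>] by (intro sum.cong) (auto simp: fun_eq_iff)
      also have "\<dots> = (\<Sum>i\<in>{1..m}. n.partial_sum \<xi> (?e i) (x i) - n.partial_sum \<xi> (?e (i - 1)) (x i))"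
        by (rule sum_repeat_entry[OF k, of "\<lambda>z j. n.partial_sum \<xi> j z"])
      also have "\<dots> = m.hat (c \<xi>) x"
        unfolding m.hat_apply[OF True] by (intro sum.cong) (simp_all add: c_def)
      finally show ?thesis using True by (simp add: pullback_def)
    qed (simp add: pullback_def dual_tuple_def)
  qed
  show ?thesis
  proof (rule m.pow.lie_bialgebra_homI)
    show "lie_alg (lie_power L n)" by (rule n.pow.lie_alg_axioms)
    show "lie_bialgebra (lie_power L m) (cobracket (lie_power L m) (r_power L r m))"
      by (rule m.pow.lie_bialgebra)
    show "lie_bialgebra (lie_power L n) (cobracket (lie_power L n) (r_power L r n))"
      by (rule n.pow.lie_bialgebra)
    show "lie_hom (lie_power L m) (lie_power L n) ?\<phi>" by (rule hom)
    show "cobracket (lie_power L m) (r_power L r m) x \<in> tensor_space (lie_power L m)"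
      if "x \<in> lie_set (lie_power L m)" for x
      unfolding cobracket_def using that m.pow.tensor by (rule m.pow.ad2_closed)
    show "cobracket (lie_power L n) (r_power L r n) x \<in> tensor_space (lie_power L n)"
      if "x \<in> lie_set (lie_power L n)" for x
      unfolding cobracket_def using that n.pow.tensor by (rule n.pow.ad2_closed)
    fix x \<zeta> \<omega>
    assume "x \<in> lie_set (lie_power L m)" "\<zeta> \<in> dual (lie_power L n)" "\<omega> \<in> dual (lie_power L n)"
    then obtain \<xi> \<eta> where x: "x \<in> tuples m V" and d: "\<xi> \<in> tuples n (dual L)" "\<eta> \<in> tuples n (dual L)"
      and \<zeta>: "\<zeta> = n.hat \<xi>" "\<omega> = n.hat \<eta>"
      by (auto elim!: n.dual_powerE)
    have \<phi>x: "?\<phi> x \<in> tuples n V" using hom x by (auto simp: lie_hom_def)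
    have total: "?e m = n" using k by (simp add: block_end_def)
    have "cobracket (lie_power L m) (r_power L r m) x (m.hat (c \<xi>)) (m.hat (c \<eta>))
        = m.pow.bracket (m.hat (c \<xi>)) (m.hat (c \<eta>)) x"
      using x by (simp add: dual_bracket_def)
    also have "\<dots> = (\<Sum>i\<in>{1..m}. m.potential_along (c \<xi>) (c \<eta>) (x i) i
        - m.potential_along (c \<xi>) (c \<eta>) (x i) (i - 1))"
      using d c_dual x by (intro m.power_bracket_apply)
    also have "\<dots> = (\<Sum>i\<in>{1..m}. n.potential_along \<xi> \<eta> (x i) (?e i)
        - n.potential_along \<xi> \<eta> (x i) (?e (i - 1)))"
      by (intro sum.cong) (auto simp: m.potential_along_def n.potential_along_def c_partial_sum total)
    also have "\<dots> = (\<Sum>j\<in>{1..n}. n.potential_along \<xi> \<eta> (?\<phi> x j) j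
        - n.potential_along \<xi> \<eta> (?\<phi> x j) (j - 1))"
      by (rule sum_repeat_entry[OF k, symmetric])
    also have "\<dots> = n.pow.bracket (n.hat \<xi>) (n.hat \<eta>) (?\<phi> x)"
      using d \<phi>x by (intro n.power_bracket_apply[symmetric])
    also have "\<dots> = cobracket (lie_power L n) (r_power L r n) (?\<phi> x) (n.hat \<xi>) (n.hat \<eta>)"
      using \<phi>x by (simp add: dual_bracket_def)
    finally show "cobracket (lie_power L m) (r_power L r m) x
        (pullback (lie_power L m) ?\<phi> \<zeta>) (pullback (lie_power L m) ?\<phi> \<omega>)
        = cobracket (lie_power L n) (r_power L r n) (?\<phi> x) \<zeta> \<omega>"
      using d by (simp add: \<zeta> pullback)
  qed
qed

theorem theorem6p2:
  fixes L :: "('k::real_normed_field, 'a::ab_group_add) lie"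
    and r :: "('k, 'a) tensor2"
    and n :: nat
  assumes "lie_algebra L"
    and "quasitriangular L r"
    and "n \<ge> 1"
  shows "quasitriangular (lie_power L n) (r_power L r n)
    \<and> lie_bracket (pointwise (pointwise (*))) (tuples n (dual L)) (power_dual_bracket L r n)
    \<and> (\<forall>\<xi>\<in>tuples n (dual L). \<forall>\<eta>\<in>tuples n (dual L).
         dual_bracket (lie_power L n) (cobracket (lie_power L n) (r_power L r n))
           (dual_tuple L n \<xi>) (dual_tuple L n \<eta>)
         = dual_tuple L n (power_dual_bracket L r n \<xi> \<eta>))
    \<and> (\<forall>m k. 1 \<le> k \<and> k \<le> m \<and> m \<le> n \<longrightarrow>
         lie_bialgebra_hom
           (lie_power L m) (cobracket (lie_power L m) (r_power L r m))
           (lie_power L n) (cobracket (lie_power L n) (r_power L r n))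
           (repeat_entry n m k))"
proof -
  interpret quasitriangular_lie L r
    using assms by unfold_locales (auto simp: quasitriangular_def)
  interpret quasitriangular_power L r n by unfold_locales
  show ?thesis
    using quasitriangular_power lie_bracket_power_dual dual_bracket_power
      lie_bialgebra_hom_repeat_entry by blast
qed

end
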